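(* Let $l\in\mathbb{N}$ and let $S\subseteq\mathbb{R}^m$ be an affine real algebraic variety. Then there exist $n\ge l$ and an $n$-player game $X$ with binary choices such that $U_{X,l}\simeq S\times\mathbb{R}^l$ (isomorphism of real algebraic varieties).
   Context: Notation: $[m]=\{1,\dots,m\}$. In this statement varieties are real algebraic varieties (real zero sets), and $\simeq$ is isomorphism of algebraic varieties. Game. An $n$-player game $X$ with binary choices is given by real payoff tensors $X^{(1)},\dots,X^{(n)}$ of format $2\times\cdots\times2$, with entries $X^{(i)}_{j_1\cdots j_n}$, $j\in[2]^n$. The Spohn variety $\mathcal{V}_X\subseteq\mathbb{P}^{2^n-1}$ (coordinates $p_{j_1\cdots j_n}$) is the zero locus of $\det M_1,\dots,\det M_n$, where the $a$-th row ($a=1,2$) of $M_i$ is $\big(\sum_{j:\,j_i=a}p_j,\ \sum_{j:\,j_i=a}X^{(i)}_jp_j\big)$. The variety $Y_{X,l}$. Consider the partition of the $n$ players into $n-2l$ singletons followed by $l$ pairs, i.e. $\mathbf{n}=(1,\dots,1,2,\dots,2)$ (this requires $n\ge2l$). The corresponding independence model is the Segre variety $\mathcal{M}_{\mathbf{n}}=(\mathbb{P}^1)^{n-2l}\times(\mathbb{P}^3)^l\subset\mathbb{P}^{2^n-1}$, with coordinates $\sigma^{(i)}_1,\sigma^{(i)}_2$ on the $i$-th factor $\mathbb{P}^1$ ($i\in[n-2l]$) and $\sigma^{(n-2l+r)}_{ab}$, $a,b\in[2]$, on the $r$-th factor $\mathbb{P}^3$ ($r\in[l]$), parametrized by $$p_{j_1\cdots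 j_n}=\prod_{i=1}^{n-2l}\sigma^{(i)}_{j_i}\prod_{r=1}^l\sigma^{(n-2l+r)}_{j_{n-2l+2r-1}\,j_{n-2l+2r}}.$$ Let $\mathcal{W}$ be the union of all coordinate hyperplanes $\{p_j=0\}$ and of the hyperplane $\{p_{++\cdots+}=0\}$, where $p_{++\cdots+}$ is the sum of all coordinates. The Nash conditional independence variety is $Y_{X,l}:=\overline{(\mathcal{V}_X\cap\mathcal{M}_{\mathbf{n}})\setminus\mathcal{W}}$ (Zariski closure). The affine open subset $U_{X,l}\subset Y_{X,l}$ is defined by $\sigma^{(1)}_2,\dots,\sigma^{(n-2l)}_2,\sigma^{(n-2l+1)}_{22},\dots,\sigma^{(n-l)}_{22}\neq0$. *)

theory Defs
  imports "HOL-Analysis.Analysis"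
begin

text \<open>Real affine space with coordinates indexed by a set \<open>I\<close> is the set \<open>I \<rightarrow>\<^sub>E UNIV\<close> of
  extensional functions. Over the infinite field of real numbers, polynomials can be identified
  with the functions they define; compare \<open>real_polynomial_function\<close>, which is not applicable
  here because the number of variables is not fixed by a type.\<close>

inductive_set poly_fun :: "'i set \<Rightarrow> (('i \<Rightarrow> real) \<Rightarrow> real) set" for I :: "'i set" where
  const: "(\<lambda>x. c) \<in> poly_fun I"
| coord: "i \<in> I \<Longrightarrow> (\<lambda>x. x i) \<in> poly_fun I"
| add: "f \<in> poly_fun I \<Longrightarrow> g \<in> poly_fun I \<Longrightarrow> (\<lambda>x. f x + g x) \<in> poly_fun I"
| mult: "f \<in> poly_fun I \<Longrightarrow> g \<in> poly_fun I \<Longrightarrow> (\<lambda>x. f x * g x) \<in> poly_fun I"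

definition affine_variety :: "nat \<Rightarrow> (nat \<Rightarrow> real) set \<Rightarrow> bool" where
  "affine_variety m S \<longleftrightarrow>
     (\<exists>P. finite P \<and> P \<subseteq> poly_fun {1..m} \<and> S = {x \<in> {1..m} \<rightarrow>\<^sub>E UNIV. \<forall>f\<in>P. f x = 0})"

text \<open>The product of \<open>S \<subseteq> \<real>\<^sup>m\<close> with \<open>\<real>\<^sup>l\<close>, inside the affine space of dimension \<open>m + l\<close>.\<close>

definition times_affine_space :: "nat \<Rightarrow> (nat \<Rightarrow> real) set \<Rightarrow> nat \<Rightarrow> (nat \<Rightarrow> real) set" where
  "times_affine_space m S l = {x \<in> {1..m + l} \<rightarrow>\<^sub>E UNIV. restrict x {1..m} \<in> S}"


text \<open>A point of the projective space with homogeneous coordinates indexed by \<open>I\<close> is the set of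
  all its representatives.\<close>

definition proj_point :: "'i set \<Rightarrow> ('i \<Rightarrow> real) \<Rightarrow> ('i \<Rightarrow> real) set" where
  "proj_point I v = {w \<in> I \<rightarrow>\<^sub>E UNIV. \<exists>c. c \<noteq> 0 \<and> (\<forall>i\<in>I. w i = c * v i)}"

definition proj_space :: "'i set \<Rightarrow> ('i \<Rightarrow> real) set set" where
  "proj_space I = {proj_point I v | v. \<exists>i\<in>I. v i \<noteq> 0}"

text \<open>Homogeneous polynomials of degree \<open>d\<close>; as usual, \<open>0\<close> is homogeneous of every degree.\<close>

definition form :: "'i set \<Rightarrow> nat \<Rightarrow> (('i \<Rightarrow> real) \<Rightarrow> real) \<Rightarrow> bool" where
  "form I d f \<longleftrightarrow> f \<in> poly_fun I \<and> (\<forall>c x. f (\<lambda>i. c * x i) = c ^ d * f x)"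

definition vanishes_at :: "(('i \<Rightarrow> real) \<Rightarrow> real) \<Rightarrow> ('i \<Rightarrow> real) set \<Rightarrow> bool" where
  "vanishes_at f x \<longleftrightarrow> (\<forall>v\<in>x. f v = 0)"

definition zariski_closure :: "'i set \<Rightarrow> ('i \<Rightarrow> real) set set \<Rightarrow> ('i \<Rightarrow> real) set set" where
  "zariski_closure I A =
     {x \<in> proj_space I. \<forall>d f. form I d f \<longrightarrow> (\<forall>a\<in>A. vanishes_at f a) \<longrightarrow> vanishes_at f x}"

text \<open>Regular maps between locally closed subsets of projective spaces: Zariski-locally on \<open>A\<close>,
  they are given by forms of equal degree without common zeros. It suffices to consider the
  basic open subsets of \<open>A\<close> on which a form \<open>g\<close> does not vanish.\<close>

definition regular_map ::
  "'i set \<Rightarrow> ('i \<Rightarrow> real) set set \<Rightarrow> 'j set \<Rightarrow> ('j \<Rightarrow> real) set set \<Rightarrow>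
   (('i \<Rightarrow> real) set \<Rightarrow> ('j \<Rightarrow> real) set) \<Rightarrow> bool" where
  "regular_map I A J B \<phi> \<longleftrightarrow>
     \<phi> ` A \<subseteq> B \<and>
     (\<forall>a\<in>A. \<exists>e g d F. form I e g \<and> \<not> vanishes_at g a \<and> (\<forall>j\<in>J. form I d (F j)) \<and>
        (\<forall>b\<in>A. \<not> vanishes_at g b \<longrightarrow>
           (\<forall>v\<in>b. (\<exists>j\<in>J. F j v \<noteq> 0) \<and> \<phi> b = proj_point J (\<lambda>j. F j v))))"

definition isomorphic_varieties ::
  "'i set \<Rightarrow> ('i \<Rightarrow> real) set set \<Rightarrow> 'j set \<Rightarrow> ('j \<Rightarrow> real) set set \<Rightarrow> bool" where
  "isomorphic_varieties I A J B \<longleftrightarrow>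
     (\<exists>\<phi> \<psi>. regular_map I A J B \<phi> \<and> regular_map J B I A \<psi> \<and>
        (\<forall>a\<in>A. \<psi> (\<phi> a) = a) \<and> (\<forall>b\<in>B. \<phi> (\<psi> b) = b))"

text \<open>The standard chart \<open>x \<mapsto> [1 : x\<^sub>1 : \<dots> : x\<^sub>k]\<close>, through which affine varieties are regarded as
  locally closed subsets of a projective space with coordinates indexed by \<open>{0..k}\<close>.\<close>

definition affine_chart :: "nat \<Rightarrow> (nat \<Rightarrow> real) \<Rightarrow> (nat \<Rightarrow> real) set" where
  "affine_chart k x = proj_point {0..k} (\<lambda>i. if i = 0 then 1 else x i)"


text \<open>Choices are elements of the two-element type \<open>2\<close>, so that they also serve as row indices;
  in this type the numeral \<open>2\<close> denotes the same element as \<open>0\<close> and is distinct from \<open>1\<close>.\<close>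

definition profiles :: "nat \<Rightarrow> (nat \<Rightarrow> 2) set" where
  "profiles n = {1..n} \<rightarrow>\<^sub>E UNIV"

text \<open>A game with \<open>n\<close> players is given by \<open>X i j\<close>, the payoff of player \<open>i \<in> {1..n}\<close> at the profile
  \<open>j \<in> profiles n\<close>; other arguments are never used.\<close>

type_synonym game = "nat \<Rightarrow> (nat \<Rightarrow> 2) \<Rightarrow> real"

definition spohn_matrix :: "nat \<Rightarrow> game \<Rightarrow> nat \<Rightarrow> ((nat \<Rightarrow> 2) \<Rightarrow> real) \<Rightarrow> real^2^2" where
  "spohn_matrix n X i p =
     (\<chi> a. vector [\<Sum>j | j \<in> profiles n \<and> j i = a. p j,
                   \<Sum>j | j \<in> profiles n \<and> j i = a. X i j * p j])"

definition spohn_variety :: "nat \<Rightarrow> game \<Rightarrow> ((nat \<Rightarrow> 2) \<Rightarrow> real) set set" where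
  "spohn_variety n X =
     {x \<in> proj_space (profiles n). \<forall>i\<in>{1..n}. vanishes_at (\<lambda>p. det (spohn_matrix n X i p)) x}"

text \<open>Here \<open>s i\<close> are coordinates on the projective line of the singleton player \<open>i\<close>, and \<open>t r\<close> are
  coordinates on the projective 3-space of the \<open>r\<close>-th pair, which consists of the players
  \<open>n - 2 * l + 2 * r - 1\<close> and \<open>n - 2 * l + 2 * r\<close>.\<close>

definition segre :: "nat \<Rightarrow> nat \<Rightarrow> (nat \<Rightarrow> 2 \<Rightarrow> real) \<Rightarrow> (nat \<Rightarrow> 2 \<Rightarrow> 2 \<Rightarrow> real) \<Rightarrow>
    ((nat \<Rightarrow> 2) \<Rightarrow> real) set" where
  "segre n l s t = proj_point (profiles n)
     (\<lambda>j. (\<Prod>i = 1..n - 2 * l. s i (j i)) *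
          (\<Prod>r = 1..l. t r (j (n - 2 * l + 2 * r - 1)) (j (n - 2 * l + 2 * r))))"

definition independence_model :: "nat \<Rightarrow> nat \<Rightarrow> ((nat \<Rightarrow> 2) \<Rightarrow> real) set set" where
  "independence_model n l =
     {segre n l s t | s t. (\<forall>i\<in>{1..n - 2 * l}. \<exists>a. s i a \<noteq> 0) \<and> (\<forall>r\<in>{1..l}. \<exists>a b. t r a b \<noteq> 0)}"

definition excluded_hyperplanes :: "nat \<Rightarrow> ((nat \<Rightarrow> 2) \<Rightarrow> real) set set" where
  "excluded_hyperplanes n =
     (\<Union>j\<in>profiles n. {x \<in> proj_space (profiles n). vanishes_at (\<lambda>p. p j) x}) \<union>
     {x \<in> proj_space (profiles n). vanishes_at (\<lambda>p. \<Sum>j\<in>profiles n. p j) x}"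

definition nash_ci_variety :: "nat \<Rightarrow> nat \<Rightarrow> game \<Rightarrow> ((nat \<Rightarrow> 2) \<Rightarrow> real) set set" where
  "nash_ci_variety n l X = zariski_closure (profiles n)
     ((spohn_variety n X \<inter> independence_model n l) - excluded_hyperplanes n)"

text \<open>The non-vanishing conditions do not depend on the choice of \<open>s\<close> and \<open>t\<close>: for a point of the
  Segre variety, each factor's coordinates are unique up to a nonzero scalar.\<close>

definition nash_ci_open :: "nat \<Rightarrow> nat \<Rightarrow> game \<Rightarrow> ((nat \<Rightarrow> 2) \<Rightarrow> real) set set" where
  "nash_ci_open n l X = {x \<in> nash_ci_variety n l X. \<exists>s t. x = segre n l s t \<and>
     (\<forall>i\<in>{1..n - 2 * l}. s i 2 \<noteq> 0) \<and> (\<forall>r\<in>{1..l}. t r 2 2 \<noteq> 0)}"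

end

theory Submission
  imports Defs
begin

text \<open>If player \<open>i\<close> is a singleton and gets payoff \<open>0\<close> for the first choice, then on the independence
  model \<open>det M\<^sub>i\<close> is a product of a factor that vanishes only on the excluded hyperplanes and of an
  expected payoff, which in the chart is an arbitrary multiaffine function of the coordinates of the
  other players. Thus the singletons can impose any system of multiaffine equations, one for each player,
  as long as the equation of a player does not involve the coordinate of that player.

  Every real affine variety is isomorphic to the solution set of such a system
  (\<open>positive_multiaffine_system\<close>). Over the reals one polynomial equation suffices, by taking a sum
  of squares. It is made multiaffine by polarization: a variable is replaced by several copies,
  so that no copy occurs twice in a monomial. The equations that identify the copies of a variable are left to the
  copies of another variable, and one more player, with constant coordinate, enforces the
  polynomial equation.

  The Zariski closure could destroy this description, because it is taken after removing the
  excluded hyperplanes, which include those where a coordinate vanishes. For the singletons nothing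
  is lost: the variety is first embedded into the positive orthant, replacing each coordinate \<open>x\<close>
  by the two positive numbers \<open>x\<^sup>2 + 1\<close> and \<open>x\<^sup>2 + x + 1\<close>, whose difference is \<open>x\<close>.

  The two players of a pair play a game of their own: the first is paid when the second makes the
  second choice, the second is paid when the choices differ. Off the excluded hyperplanes the two
  determinants say that the two rows of the \<open>2 \<times> 2\<close> matrix \<open>\<sigma>\<close> of the pair agree
  (\<open>pair_line\<close>), so in the chart \<open>\<sigma>\<^sub>2\<^sub>2 = 1\<close> the pair contributes the line
  \<open>\<sigma>\<^sub>1\<^sub>1 = \<sigma>\<^sub>2\<^sub>1 = c, \<sigma>\<^sub>1\<^sub>2 = 1\<close> without the points \<open>c = 0\<close> and \<open>c = -1\<close>. The closure fills in these
  points, since a polynomial that vanishes on all but finitely many points of a line vanishes on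
  the line. It adds nothing else in the chart, since all conditions above, the multiaffine equations
  included, are linear forms in the coordinates \<open>p\<^sub>j\<close> (\<open>nash_ci_open_realizing_game\<close>). What remains
  are two mutually inverse maps given globally by forms: coordinates \<open>p\<^sub>j\<close> and their
  differences in one direction, products of quadratic and linear forms in the other.\<close>

section \<open>Polynomial functions\<close>

lemma poly_fun_cong:
  assumes "f \<in> poly_fun I" and "\<And>i. i \<in> I \<Longrightarrow> x i = y i"
  shows "f x = f y"
  using assms by (induction rule: poly_fun.induct) auto

lemma poly_fun_mono:
  assumes "f \<in> poly_fun I" and "I \<subseteq> J"
  shows "f \<in> poly_fun J"
  using assms by (induction rule: poly_fun.induct) (auto intro: poly_fun.intros)

lemma poly_fun_compose:
  assumes "f \<in> poly_fun J" and "\<And>j. j \<in> J \<Longrightarrow> (\<lambda>x. \<sigma> j x) \<in> poly_fun I"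
  shows "(\<lambda>x. f (\<lambda>j. \<sigma> j x)) \<in> poly_fun I"
  using assms(1) by (induction rule: poly_fun.induct) (auto intro: poly_fun.intros assms(2))

lemma poly_fun_diff:
  assumes "f \<in> poly_fun I" and "g \<in> poly_fun I"
  shows "(\<lambda>x. f x - g x) \<in> poly_fun I"
proof -
  have "(\<lambda>x. f x + (-1) * g x) \<in> poly_fun I"
    by (intro poly_fun.intros assms)
  then show ?thesis by simp
qed

lemma poly_fun_sum:
  assumes "\<And>a. a \<in> A \<Longrightarrow> f a \<in> poly_fun I"
  shows "(\<lambda>x. \<Sum>a\<in>A. f a x) \<in> poly_fun I"
  using assms by (induction A rule: infinite_finite_induct) (auto intro: poly_fun.intros)

lemma poly_fun_power:
  assumes "f \<in> poly_fun I"
  shows "(\<lambda>x. f x ^ k) \<in> poly_fun I"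
  using assms by (induction k) (auto intro: poly_fun.intros)

lemma poly_fun_continuous:
  assumes "f \<in> poly_fun I" and "\<And>i. i \<in> I \<Longrightarrow> continuous_on T (\<lambda>t. \<gamma> t i)"
  shows "continuous_on T (\<lambda>t. f (\<gamma> t))"
  using assms by (induction rule: poly_fun.induct) (auto intro!: continuous_intros)


lemma form_cong:
  assumes "form I d f" and "\<And>i. i \<in> I \<Longrightarrow> x i = y i"
  shows "f x = f y"
  using assms poly_fun_cong unfolding form_def by blast

lemma form_mono: "form I d f \<Longrightarrow> I \<subseteq> J \<Longrightarrow> form J d f"
  unfolding form_def using poly_fun_mono by blast

lemma form_coord: "i \<in> I \<Longrightarrow> form I 1 (\<lambda>x. x i)"
  unfolding form_def by (auto intro: poly_fun.intros)

lemma form_add: "form I d f \<Longrightarrow> form I d g \<Longrightarrow> form I d (\<lambda>x. f x + g x)"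
  unfolding form_def by (auto intro: poly_fun.intros simp: algebra_simps)

lemma form_diff: "form I d f \<Longrightarrow> form I d g \<Longrightarrow> form I d (\<lambda>x. f x - g x)"
  unfolding form_def by (auto intro: poly_fun_diff simp: algebra_simps)

lemma form_mult: "form I d f \<Longrightarrow> form I e g \<Longrightarrow> form I (d + e) (\<lambda>x. f x * g x)"
  unfolding form_def by (auto intro: poly_fun.intros simp: algebra_simps power_add)

lemma form_power: "form I d f \<Longrightarrow> form I (d * k) (\<lambda>x. f x ^ k)"
  unfolding form_def by (auto intro: poly_fun_power simp: power_mult_distrib power_mult)

lemma form_prod:
  assumes "finite A" and "\<And>a. a \<in> A \<Longrightarrow> form I d (f a)"
  shows "form I (card A * d) (\<lambda>x. \<Prod>a\<in>A. f a x)"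
  using assms
proof (induction A rule: finite_induct)
  case empty
  then show ?case by (auto simp: form_def intro: poly_fun.intros)
next
  case (insert a A)
  then have "form I (d + card A * d) (\<lambda>x. f a x * (\<Prod>a\<in>A. f a x))"
    by (intro form_mult) auto
  with insert show ?case by simp
qed

lemma form_linear:
  assumes "J \<subseteq> I"
  shows "form I 1 (\<lambda>x. \<Sum>j\<in>J. c j * x j)"
  unfolding form_def using assms
  by (auto intro!: poly_fun_sum poly_fun.intros simp: sum_distrib_left mult.left_commute)


section \<open>Multiaffine functions\<close>

text \<open>The functions that are affine in each single variable of a finite subset of \<open>V\<close>. They are generated
  from monomials by addition, so that statements about the coefficients can be proved by induction
  on the function instead of manipulating sums over subsets.\<close>

inductive_set multiaffine :: "'v set \<Rightarrow> (('v \<Rightarrow> real) \<Rightarrow> real) set" for V :: "'v set" where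
  monomial: "finite A \<Longrightarrow> A \<subseteq> V \<Longrightarrow> (\<lambda>y. c * (\<Prod>v\<in>A. y v)) \<in> multiaffine V"
| add: "f \<in> multiaffine V \<Longrightarrow> g \<in> multiaffine V \<Longrightarrow> (\<lambda>y. f y + g y) \<in> multiaffine V"

lemma multiaffine_const: "(\<lambda>y. c) \<in> multiaffine V"
  using multiaffine.monomial[of "{}" V c] by simp

lemma multiaffine_scaled_coord: "v \<in> V \<Longrightarrow> (\<lambda>y. c * y v) \<in> multiaffine V"
  using multiaffine.monomial[of "{v}" V c] by simp

lemma multiaffine_coord: "v \<in> V \<Longrightarrow> (\<lambda>y. y v) \<in> multiaffine V"
  using multiaffine_scaled_coord[of v V 1] by simp

lemma multiaffine_mono: "f \<in> multiaffine V \<Longrightarrow> V \<subseteq> W \<Longrightarrow> f \<in> multiaffine W"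
  by (induction rule: multiaffine.induct) (auto intro: multiaffine.intros)

lemma multiaffine_coord_diff_const:
  assumes "v \<in> V" shows "(\<lambda>y. y v - c) \<in> multiaffine V"
  using multiaffine.add[OF multiaffine_coord[OF assms] multiaffine_const[of "-c"]] by simp

lemma multiaffine_coord_diff:
  assumes "v \<in> V" "w \<in> V" shows "(\<lambda>y. y v - y w) \<in> multiaffine V"
  using multiaffine.add[OF multiaffine_coord[OF assms(1)] multiaffine_scaled_coord[OF assms(2), of "-1"]]
  by simp

lemma multiaffine_mult:
  assumes "f \<in> multiaffine V" and "g \<in> multiaffine W" and "V \<inter> W = {}"
  shows "(\<lambda>y. f y * g y) \<in> multiaffine (V \<union> W)"
  using assms(1)
proof (induction rule: multiaffine.induct)
  case (monomial A c)
  show ?case using assms(2)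
  proof (induction rule: multiaffine.induct)
    case (monomial B b)
    have "(\<Prod>v\<in>A \<union> B. y v) = (\<Prod>v\<in>A. y v) * (\<Prod>v\<in>B. y v)" for y :: "'a \<Rightarrow> real"
      using monomial \<open>finite A\<close> \<open>A \<subseteq> V\<close> assms(3) by (intro prod.union_disjoint) auto
    moreover have "(\<lambda>y. (c * b) * (\<Prod>v\<in>A \<union> B. y v)) \<in> multiaffine (V \<union> W)"
      using monomial \<open>finite A\<close> \<open>A \<subseteq> V\<close> by (intro multiaffine.monomial) auto
    ultimately show ?case by (simp add: ac_simps)
  qed (auto simp: algebra_simps dest: multiaffine.add)
qed (auto simp: algebra_simps dest: multiaffine.add)

lemma multiaffine_reindex:
  assumes "f \<in> multiaffine V" and "inj_on g V"
  shows "(\<lambda>y. f (\<lambda>v. y (g v))) \<in> multiaffine (g ` V)"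
  using assms(1)
proof (induction rule: multiaffine.induct)
  case (monomial A c)
  have "(\<lambda>y. c * (\<Prod>v\<in>g ` A. y v)) \<in> multiaffine (g ` V)"
    using monomial by (intro multiaffine.monomial) auto
  moreover have "inj_on g A" using assms(2) monomial by (auto intro: inj_on_subset)
  ultimately show ?case by (simp add: prod.reindex)
qed (auto intro: multiaffine.add)

text \<open>A product is made multiaffine by giving the second factor fresh copies of the variables, which are
  obtained by shifting the index of the copies.\<close>

lemma polarization:
  assumes "f \<in> poly_fun I"
  shows "\<exists>d. \<exists>F\<in>multiaffine (I \<times> {..<d::nat}). \<forall>x. F (\<lambda>v. x (fst v)) = f x"
  using assms
proof (induction rule: poly_fun.induct)
  case (const c)
  show ?case
    by (intro exI[of _ 0] bexI[of _ "\<lambda>y. c"] multiaffine_const) simp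
next
  case (coord i)
  then have "(\<lambda>y. y (i, 0)) \<in> multiaffine (I \<times> {..<Suc 0})"
    by (intro multiaffine_coord) auto
  then show ?case by (intro exI[of _ "Suc 0"] bexI[of _ "\<lambda>y. y (i, 0)"]) simp_all
next
  case (add f g)
  then obtain d F e G where F: "F \<in> multiaffine (I \<times> {..<d::nat})" "\<And>x. F (\<lambda>v. x (fst v)) = f x"
    and G: "G \<in> multiaffine (I \<times> {..<e::nat})" "\<And>x. G (\<lambda>v. x (fst v)) = g x" by metis
  have "F \<in> multiaffine (I \<times> {..<max d e})" "G \<in> multiaffine (I \<times> {..<max d e})"
    using F(1) G(1) by (auto elim!: multiaffine_mono)
  then have *: "(\<lambda>y. F y + G y) \<in> multiaffine (I \<times> {..<max d e})" by (rule multiaffine.add)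
  show ?case using F(2) G(2) by (intro exI[of _ "max d e"] bexI[OF _ *]) simp
next
  case (mult f g)
  then obtain d F e G where F: "F \<in> multiaffine (I \<times> {..<d::nat})" "\<And>x. F (\<lambda>v. x (fst v)) = f x"
    and G: "G \<in> multiaffine (I \<times> {..<e::nat})" "\<And>x. G (\<lambda>v. x (fst v)) = g x" by metis
  define s where "s = (\<lambda>(i::'a, k). (i, d + k))"
  have "(\<lambda>y. G (\<lambda>v. y (s v))) \<in> multiaffine (s ` (I \<times> {..<e}))"
    by (rule multiaffine_reindex[OF G(1)]) (auto simp: s_def inj_on_def)
  then have "(\<lambda>y. F y * G (\<lambda>v. y (s v))) \<in> multiaffine (I \<times> {..<d} \<union> s ` (I \<times> {..<e}))"
    by (intro multiaffine_mult F) (auto simp: s_def)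
  then have *: "(\<lambda>y. F y * G (\<lambda>v. y (s v))) \<in> multiaffine (I \<times> {..<d + e})"
    by (rule multiaffine_mono) (auto simp: s_def)
  have "fst (s v) = fst v" for v by (simp add: s_def split_beta)
  then show ?case using F(2) G(2) by (intro exI[of _ "d + e"] bexI[OF _ *]) simp
qed


section \<open>Affine varieties as positive solutions of multiaffine systems\<close>

text \<open>Each coordinate \<open>w k\<close> is encoded by the positive numbers \<open>(w k)\<^sup>2 + 1\<close> and \<open>(w k)\<^sup>2 + w k + 1\<close>,
  stored at \<open>(k, False)\<close> and \<open>(k, True)\<close>, and recovered as their difference. The coordinate \<open>w 0 = 1\<close>
  makes \<open>w\<close> the vector of homogeneous coordinates of an affine point, and guarantees that there is
  at least one coordinate even if \<open>m = 0\<close>.\<close>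

lemma positive_coordinates_equation:
  fixes P :: "((nat \<Rightarrow> real) \<Rightarrow> real) set"
  assumes "finite P" and "P \<subseteq> poly_fun {1..m}"
  shows "\<exists>f\<in>poly_fun ({0..m} \<times> (UNIV :: bool set)). \<forall>a. f a = 0 \<longleftrightarrow>
    (\<exists>w. w 0 = 1 \<and> (\<forall>h\<in>P. h w = 0) \<and>
       (\<forall>k\<in>{0..m}. a (k, False) = (w k)\<^sup>2 + 1 \<and> a (k, True) = (w k)\<^sup>2 + w k + 1))"
proof -
  define f :: "(nat \<times> bool \<Rightarrow> real) \<Rightarrow> real" where
    "f = (\<lambda>a. (\<Sum>k\<in>{0..m}. (a (k, False) - ((a (k, True) - a (k, False))\<^sup>2 + 1))\<^sup>2) +
           (a (0, True) - a (0, False) - 1)\<^sup>2 +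
           (\<Sum>h\<in>P. (h (\<lambda>k. a (k, True) - a (k, False)))\<^sup>2))"
  have hP: "(\<lambda>a. h (\<lambda>k. a (k, True) - a (k, False))) \<in> poly_fun ({0..m} \<times> (UNIV :: bool set))"
    if "h \<in> P" for h
  proof (rule poly_fun_compose[of h "{1..m}"])
    show "h \<in> poly_fun {1..m}" using that assms(2) by blast
    show "(\<lambda>a. a (k, True) - a (k, False)) \<in> poly_fun ({0..m} \<times> (UNIV :: bool set))"
      if "k \<in> {1..m}" for k
      by (rule poly_fun_diff; rule poly_fun.coord) (use that in auto)
  qed
  have a: "(\<lambda>a. a (k, b)) \<in> poly_fun ({0..m} \<times> (UNIV :: bool set))" if "k \<in> {0..m}" for k b
    using that by (intro poly_fun.coord) auto
  have "f \<in> poly_fun ({0..m} \<times> UNIV)"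
    unfolding f_def
    by (rule poly_fun.add poly_fun_sum poly_fun_power poly_fun_diff hP a poly_fun.const
        | assumption | simp)+
  moreover have "f a = 0 \<longleftrightarrow> (\<exists>w. w 0 = 1 \<and> (\<forall>h\<in>P. h w = 0) \<and>
       (\<forall>k\<in>{0..m}. a (k, False) = (w k)\<^sup>2 + 1 \<and> a (k, True) = (w k)\<^sup>2 + w k + 1))" for a
  proof -
    let ?w = "\<lambda>k. a (k, True) - a (k, False)"
    have "f a = 0 \<longleftrightarrow> (\<forall>k\<in>{0..m}. a (k, False) - ((?w k)\<^sup>2 + 1) = 0) \<and> ?w 0 - 1 = 0 \<and> (\<forall>h\<in>P. h ?w = 0)"
      using assms(1)
      by (simp add: f_def add_nonneg_eq_0_iff sum_nonneg add_nonneg_nonneg sum_nonneg_eq_0_iff)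
    also have "\<dots> \<longleftrightarrow> (\<exists>w. w 0 = 1 \<and> (\<forall>h\<in>P. h w = 0) \<and>
       (\<forall>k\<in>{0..m}. a (k, False) = (w k)\<^sup>2 + 1 \<and> a (k, True) = (w k)\<^sup>2 + w k + 1))"
      (is "?L \<longleftrightarrow> ?R")
    proof
      assume ?L
      then show ?R by (intro exI[of _ ?w]) (auto simp: algebra_simps)
    next
      assume ?R
      then obtain w where w: "w 0 = 1" "\<forall>h\<in>P. h w = 0"
        "\<And>k. k \<le> m \<Longrightarrow> a (k, False) = (w k)\<^sup>2 + 1 \<and> a (k, True) = (w k)\<^sup>2 + w k + 1" by auto
      have wk: "?w k = w k" if "k \<le> m" for k using w(3)[OF that] by simp
      have "h ?w = h w" if "h \<in> P" for h
        by (rule poly_fun_cong[where I = "{1..m}"]) (use that assms(2) wk in auto)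
      then have "\<forall>h\<in>P. h ?w = 0" using w(2) by metis
      moreover have "?w 0 - 1 = 0" using wk[of 0] w(1) by simp
      moreover have "\<forall>k\<in>{0..m}. a (k, False) - ((?w k)\<^sup>2 + 1) = 0"
      proof
        fix k assume "k \<in> {0..m}"
        then have "k \<le> m" by simp
        show "a (k, False) - ((?w k)\<^sup>2 + 1) = 0" unfolding wk[OF \<open>k \<le> m\<close>] using w(3)[OF \<open>k \<le> m\<close>] by simp
      qed
      ultimately show ?L by blast
    qed
    finally show ?thesis .
  qed
  ultimately show ?thesis by blast
qed

text \<open>The forms \<open>Q i\<close> express the unknowns of the system by homogeneous coordinates \<open>w\<close> of a point of the
  variety; conversely \<open>w\<close> is recovered from differences of unknowns. A system of this
  shape can be imposed by singleton players, whose coordinates are the unknowns.\<close>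

lemma positive_multiaffine_system:
  fixes P :: "((nat \<Rightarrow> real) \<Rightarrow> real) set"
  assumes "finite P" and "P \<subseteq> poly_fun {1..m}"
  shows "\<exists>N (E :: nat \<Rightarrow> (nat \<Rightarrow> real) \<Rightarrow> real) Q pos neg.
    (\<forall>i\<in>{1..N}. E i \<in> multiaffine ({1..N} - {i})) \<and>
    (\<forall>i\<in>{1..N}. form {0..m} 2 (Q i) \<and> (\<forall>w. w 0 \<noteq> 0 \<longrightarrow> Q i w > 0)) \<and>
    (\<forall>k\<in>{0..m}. pos k \<in> {1..N} \<and> neg k \<in> {1..N} \<and> (\<forall>w. Q (pos k) w - Q (neg k) w = w k * w 0)) \<and>
    (\<forall>y. (\<forall>i\<in>{1..N}. E i y = 0) \<longleftrightarrow>
      (\<exists>w. w 0 = 1 \<and> (\<forall>h\<in>P. h w = 0) \<and> (\<forall>i\<in>{1..N}. y i = Q i w)))"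
proof -
  let ?I = "{0..m} \<times> (UNIV :: bool set)"
  obtain f where f: "f \<in> poly_fun ?I" and f0: "\<And>a. f a = 0 \<longleftrightarrow>
    (\<exists>w. w 0 = 1 \<and> (\<forall>h\<in>P. h w = 0) \<and>
       (\<forall>k\<in>{0..m}. a (k, False) = (w k)\<^sup>2 + 1 \<and> a (k, True) = (w k)\<^sup>2 + w k + 1))"
    using positive_coordinates_equation[OF assms] by blast
  obtain d F where F: "F \<in> multiaffine (?I \<times> {..<d::nat})" and Ff: "\<And>x. F (\<lambda>v. x (fst v)) = f x"
    using polarization[OF f] by blast
  let ?C = "?I \<times> {..<Suc d}"
  \<comment> \<open>The unknown \<open>Some (i, c)\<close> is copy \<open>c\<close> of coordinate \<open>i\<close>, and \<open>None\<close> is an unknown that is forced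
    to be \<open>1\<close>. There are \<open>d + 1\<close> copies, one more than polarization needs, so that copy \<open>0\<close> exists
    even if \<open>d = 0\<close>.\<close>
  define V where "V = insert None (Some ` ?C)"
  \<comment> \<open>The copies of \<open>(k, b)\<close> compare the copies of \<open>(k, \<not> b)\<close> with each other. A copy with index \<open>0\<close> has
    nothing to compare and forces the unknown \<open>None\<close> to be \<open>1\<close> instead.\<close>
  define E where "E v y = (case v of
        None \<Rightarrow> F (\<lambda>c. y (Some c))
      | Some ((k, b), 0) \<Rightarrow> y None - 1
      | Some ((k, b), Suc c) \<Rightarrow> y (Some ((k, \<not> b), Suc c)) - y (Some ((k, \<not> b), 0)))"
    for v :: "((nat \<times> bool) \<times> nat) option" and y :: "((nat \<times> bool) \<times> nat) option \<Rightarrow> real"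
  define Q where "Q v w = (case v of
        None \<Rightarrow> (w 0)\<^sup>2
      | Some ((k, b), c) \<Rightarrow> if b then (w k)\<^sup>2 + w k * w 0 + (w 0)\<^sup>2 else (w k)\<^sup>2 + (w 0)\<^sup>2)"
    for v :: "((nat \<times> bool) \<times> nat) option" and w :: "nat \<Rightarrow> real"
  have E: "E v \<in> multiaffine (V - {v})" if v: "v \<in> V" for v
  proof (cases v)
    case None
    have "(\<lambda>y. F (\<lambda>c. y (Some c))) \<in> multiaffine (Some ` (?I \<times> {..<d}))"
      by (rule multiaffine_reindex[OF F]) simp
    then have "(\<lambda>y. F (\<lambda>c. y (Some c))) \<in> multiaffine (V - {None})"
      by (rule multiaffine_mono) (auto simp: V_def)
    then show ?thesis using None by (simp add: E_def[abs_def])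
  next
    case (Some x)
    obtain k b c where x: "x = ((k, b), c)" by (metis surj_pair)
    show ?thesis
    proof (cases c)
      case 0
      then have "E v = (\<lambda>y. y None - 1)" by (auto simp: E_def Some x)
      then show ?thesis using Some by (auto simp: V_def intro: multiaffine_coord_diff_const)
    next
      case (Suc c')
      then have "E v = (\<lambda>y. y (Some ((k, \<not> b), Suc c')) - y (Some ((k, \<not> b), 0)))"
        by (auto simp: E_def Some x)
      then show ?thesis using v Suc Some x by (auto simp: V_def intro!: multiaffine_coord_diff)
    qed
  qed
  have form_Q: "form {0..m} 2 (Q v)" if v: "v \<in> V" for v
  proof -
    have sq: "form {0..m} 2 (\<lambda>w. (w k)\<^sup>2)" if "k \<le> m" for k
      using form_power[OF form_coord, of k "{0..m}" 2] that by simp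
    have xy: "form {0..m} 2 (\<lambda>w. w k * w 0)" if "k \<le> m" for k
      using form_mult[OF form_coord form_coord, of k "{0..m}" 0] that by (simp add: numeral_2_eq_2)
    show ?thesis
    proof (cases v)
      case None
      then show ?thesis using sq by (simp add: Q_def[abs_def])
    next
      case (Some x)
      obtain k b c where x: "x = ((k, b), c)" by (metis surj_pair)
      have "k \<le> m" using v Some x by (auto simp: V_def)
      then show ?thesis using Some x sq xy by (cases b) (auto simp: Q_def[abs_def] intro!: form_add)
    qed
  qed
  have Q_pos: "Q v w > 0" if "w 0 \<noteq> 0" for v w
  proof -
    \<comment> \<open>Completing the square.\<close>
    have "4 * ((w k)\<^sup>2 + w k * w 0 + (w 0)\<^sup>2) = (2 * w k + w 0)\<^sup>2 + 3 * (w 0)\<^sup>2" for k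
      by (simp add: power2_eq_square algebra_simps)
    moreover have "(2 * w k + w 0)\<^sup>2 + 3 * (w 0)\<^sup>2 > 0" for k
      using that by (intro add_nonneg_pos) auto
    ultimately have "(w k)\<^sup>2 + w k * w 0 + (w 0)\<^sup>2 > 0" for k
      by (metis mult_pos_pos zero_less_mult_pos zero_less_numeral)
    moreover have "(w k)\<^sup>2 + (w 0)\<^sup>2 > 0" for k using that by (intro add_nonneg_pos) auto
    ultimately show ?thesis using that by (auto simp: Q_def split: option.split prod.split)
  qed
  have sol: "(\<forall>v\<in>V. E v y = 0) \<longleftrightarrow>
      (\<exists>w. w 0 = 1 \<and> (\<forall>h\<in>P. h w = 0) \<and> (\<forall>v\<in>V. y v = Q v w))" (is "?L \<longleftrightarrow> ?R") for y
  proof -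
    define a where "a i = y (Some (i, 0))" for i
    have diag: "F (\<lambda>c. y (Some c)) = f a" if "\<And>i c. i \<in> ?I \<Longrightarrow> c < Suc d \<Longrightarrow> y (Some (i, c)) = a i"
    proof -
      have "f a = F (\<lambda>v. a (fst v))" by (simp add: Ff)
      also have "F g = F g'" if "\<And>v. v \<in> ?I \<times> {..<d} \<Longrightarrow> g v = g' v" for g g'
        using F that
      proof (induction rule: multiaffine.induct)
        case (monomial A c)
        then have "prod g A = prod g' A" by (intro prod.cong) auto
        then show ?case by simp
      qed auto
      then have "F (\<lambda>v. a (fst v)) = F (\<lambda>c. y (Some c))" using that by force
      finally show ?thesis by simp
    qed
    show ?thesis
    proof
      assume L: ?L
      have y0: "y None = 1"
      proof -
        have "Some ((0, False), 0) \<in> V" by (auto simp: V_def)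
        with L have "E (Some ((0, False), 0)) y = 0" by blast
        then show ?thesis by (simp add: E_def)
      qed
      have ya: "y (Some (i, c)) = a i" if i: "i \<in> ?I" and c: "c < Suc d" for i c
      proof (cases c)
        case 0
        then show ?thesis by (simp add: a_def)
      next
        case (Suc c')
        obtain k b where kb: "i = (k, b)" by (metis surj_pair)
        have "Some ((k, \<not> b), Suc c') \<in> V" using i c kb Suc by (auto simp: V_def)
        with L have "E (Some ((k, \<not> b), Suc c')) y = 0" by blast
        then show ?thesis using kb Suc by (simp add: E_def a_def)
      qed
      have "E None y = 0" using L by (auto simp: V_def)
      then have "f a = 0" using diag[OF ya] by (simp add: E_def)
      then obtain w where w: "w 0 = 1" "\<forall>h\<in>P. h w = 0"
        "\<forall>k\<in>{0..m}. a (k, False) = (w k)\<^sup>2 + 1 \<and> a (k, True) = (w k)\<^sup>2 + w k + 1"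
        using f0[of a] by auto
      have "y v = Q v w" if v: "v \<in> V" for v
      proof (cases v)
        case None
        then show ?thesis using y0 w by (simp add: Q_def)
      next
        case (Some x)
        obtain k b c where x: "x = ((k, b), c)" by (metis surj_pair)
        have "k \<in> {0..m}" "c < Suc d" using v Some x by (auto simp: V_def)
        then show ?thesis using ya[of "(k, b)" c] w Some x by (cases b) (auto simp: Q_def)
      qed
      then show ?R using w by blast
    next
      assume ?R
      then obtain w where w: "w 0 = 1" "\<forall>h\<in>P. h w = 0" and yQ: "\<And>v. v \<in> V \<Longrightarrow> y v = Q v w" by blast
      have yS: "y (Some ((k, b), c)) = (w k)\<^sup>2 + (if b then w k else 0) + 1"
        if "k \<le> m" "c < Suc d" for k b c
        using yQ[of "Some ((k, b), c)"] that w(1) by (auto simp: V_def Q_def)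
      have "\<forall>k\<in>{0..m}. a (k, False) = (w k)\<^sup>2 + 1 \<and> a (k, True) = (w k)\<^sup>2 + w k + 1"
        using yS by (auto simp: a_def)
      with w have "f a = 0" unfolding f0 by blast
      moreover have "y (Some (i, c)) = a i" if "i \<in> ?I" "c < Suc d" for i c
        using that by (cases i) (simp add: yS a_def)
      ultimately have "E None y = 0" using diag by (simp add: E_def)
      moreover have "y None = 1" using yQ[of None] w by (simp add: V_def Q_def)
      ultimately show ?L
        by (auto simp: V_def E_def yS split: nat.split)
    qed
  qed
  have "finite V" by (simp add: V_def)
  then obtain h where h: "bij_betw h {1..card V} V" using ex_bij_betw_nat_finite_1 by blast
  define g where "g = inv_into {1..card V} h"
  have g: "bij_betw g V {1..card V}" unfolding g_def using h by (rule bij_betw_inv_into)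
  have hV: "h i \<in> V" if "i \<in> {1..card V}" for i using h that by (auto simp: bij_betw_def)
  have gV: "g v \<in> {1..card V}" if "v \<in> V" for v using bij_betwE[OF g] that by blast
  have gh: "g (h i) = i" if "i \<in> {1..card V}" for i
    using h that by (simp add: g_def bij_betw_def inv_into_f_f)
  have hg: "h (g v) = v" if "v \<in> V" for v
    using h that by (simp add: g_def bij_betw_def f_inv_into_f)
  have "(\<lambda>y. E (h i) (\<lambda>v. y (g v))) \<in> multiaffine ({1..card V} - {i})" if i: "i \<in> {1..card V}" for i
  proof -
    have "(\<lambda>y. E (h i) (\<lambda>v. y (g v))) \<in> multiaffine (g ` (V - {h i}))"
      using g by (intro multiaffine_reindex E hV i) (auto simp: bij_betw_def inj_on_diff)
    moreover have "g ` (V - {h i}) \<subseteq> {1..card V} - {i}"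
      using gV hg by fastforce
    ultimately show ?thesis by (rule multiaffine_mono)
  qed
  moreover have "form {0..m} 2 (Q (h i)) \<and> (\<forall>w. w 0 \<noteq> 0 \<longrightarrow> Q (h i) w > 0)" if "i \<in> {1..card V}" for i
    using form_Q hV Q_pos that by blast
  moreover have "g (Some ((k, b), 0)) \<in> {1..card V}" "h (g (Some ((k, b), 0))) = Some ((k, b), 0)"
    if "k \<in> {0..m}" for k b
  proof -
    have "Some ((k, b), 0) \<in> V" using that by (auto simp: V_def)
    then show "g (Some ((k, b), 0)) \<in> {1..card V}" "h (g (Some ((k, b), 0))) = Some ((k, b), 0)"
      by (rule gV, rule hg)
  qed
  moreover have "Q (Some ((k, True), 0)) w - Q (Some ((k, False), 0)) w = w k * w 0" for k w
    by (simp add: Q_def)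
  moreover have "(\<forall>i\<in>{1..card V}. E (h i) (\<lambda>v. y (g v)) = 0) \<longleftrightarrow>
      (\<exists>w. w 0 = 1 \<and> (\<forall>p\<in>P. p w = 0) \<and> (\<forall>i\<in>{1..card V}. y i = Q (h i) w))" for y
  proof -
    have "(\<forall>i\<in>{1..card V}. E (h i) (\<lambda>v. y (g v)) = 0) \<longleftrightarrow> (\<forall>v\<in>V. E v (\<lambda>v. y (g v)) = 0)"
      using hV gV hg by metis
    also have "\<dots> \<longleftrightarrow> (\<exists>w. w 0 = 1 \<and> (\<forall>p\<in>P. p w = 0) \<and> (\<forall>v\<in>V. y (g v) = Q v w))"
      by (rule sol)
    also have "(\<lambda>w. \<forall>v\<in>V. y (g v) = Q v w) = (\<lambda>w. \<forall>i\<in>{1..card V}. y i = Q (h i) w)"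
      using hV gV hg gh by (metis (no_types, lifting))
    finally show ?thesis .
  qed
  ultimately show ?thesis
    by (intro exI[of _ "card V"] exI[of _ "\<lambda>i y. E (h i) (\<lambda>v. y (g v))"] exI[of _ "\<lambda>i. Q (h i)"]
        exI[of _ "\<lambda>k. g (Some ((k, True), 0))"] exI[of _ "\<lambda>k. g (Some ((k, False), 0))"]) simp
qed



section \<open>Points of projective space and isomorphisms given by forms\<close>

lemma proj_point_cong:
  assumes "\<And>i. i \<in> I \<Longrightarrow> v i = w i"
  shows "proj_point I v = proj_point I w"
  using assms by (auto simp: proj_point_def)

lemma proj_point_scale:
  assumes "c \<noteq> 0"
  shows "proj_point I (\<lambda>i. c * v i) = proj_point I v"
proof (intro set_eqI iffI)
  fix w assume "w \<in> proj_point I v"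
  then obtain d where d: "w \<in> I \<rightarrow>\<^sub>E UNIV" "d \<noteq> 0" "\<forall>i\<in>I. w i = d * v i" by (auto simp: proj_point_def)
  then show "w \<in> proj_point I (\<lambda>i. c * v i)" using assms
    unfolding proj_point_def by (auto intro!: exI[of _ "d / c"])
next
  fix w assume "w \<in> proj_point I (\<lambda>i. c * v i)"
  then obtain d where d: "w \<in> I \<rightarrow>\<^sub>E UNIV" "d \<noteq> 0" "\<forall>i\<in>I. w i = d * (c * v i)" by (auto simp: proj_point_def)
  then show "w \<in> proj_point I v" using assms
    unfolding proj_point_def by (auto intro!: exI[of _ "d * c"])
qed

lemma restrict_in_proj_point: "restrict v I \<in> proj_point I v"
  by (auto simp: proj_point_def intro!: exI[of _ 1])

lemma vanishes_at_proj_point: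
  assumes "form I d f"
  shows "vanishes_at f (proj_point I v) \<longleftrightarrow> f v = 0"
proof
  assume "vanishes_at f (proj_point I v)"
  then have "f (restrict v I) = 0" using restrict_in_proj_point unfolding vanishes_at_def by blast
  moreover have "f (restrict v I) = f v" by (rule form_cong[OF assms]) simp
  ultimately show "f v = 0" by simp
next
  assume 0: "f v = 0"
  show "vanishes_at f (proj_point I v)" unfolding vanishes_at_def
  proof
    fix w assume "w \<in> proj_point I v"
    then obtain c where c: "\<forall>i\<in>I. w i = c * v i" by (auto simp: proj_point_def)
    then have "f w = f (\<lambda>i. c * v i)" by (intro form_cong[OF assms]) auto
    then show "f w = 0" using assms 0 by (simp add: form_def)
  qed
qed

text \<open>A map that is given by the same forms at all points is regular: the local description in the
  definition applies with \<open>g = 1\<close>, a form of degree \<open>0\<close>.\<close>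

lemma regular_map_by_forms:
  assumes F: "\<And>j. j \<in> J \<Longrightarrow> form J' d (F j)" and J: "\<And>z. z \<in> T \<Longrightarrow> \<exists>j\<in>J. g z j \<noteq> 0"
    and Fg: "\<And>z j. z \<in> T \<Longrightarrow> j \<in> J \<Longrightarrow> F j (f z) = g z j"
  shows "\<exists>\<phi>. regular_map J' ((\<lambda>z. proj_point J' (f z)) ` T) J ((\<lambda>z. proj_point J (g z)) ` T) \<phi> \<and>
    (\<forall>z\<in>T. \<phi> (proj_point J' (f z)) = proj_point J (g z))"
proof -
  let ?A = "(\<lambda>z. proj_point J' (f z)) ` T"
  define \<phi> where "\<phi> x = proj_point J (\<lambda>j. F j (SOME v. v \<in> x))" for x
  have val: "proj_point J (\<lambda>j. F j v) = proj_point J (g z) \<and> (\<exists>j\<in>J. F j v \<noteq> 0)"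
    if z: "z \<in> T" and v: "v \<in> proj_point J' (f z)" for z v
  proof -
    obtain b where b: "b \<noteq> 0" "\<forall>i\<in>J'. v i = b * f z i" using v by (auto simp: proj_point_def)
    have *: "F j v = b ^ d * g z j" if "j \<in> J" for j
    proof -
      have "F j v = F j (\<lambda>i. b * f z i)" using b by (intro form_cong[OF F[OF that]]) auto
      also have "\<dots> = b ^ d * F j (f z)" using F[OF that] by (simp add: form_def)
      finally show ?thesis using Fg[OF z that] by simp
    qed
    then have "proj_point J (\<lambda>j. F j v) = proj_point J (\<lambda>j. b ^ d * g z j)"
      by (rule proj_point_cong)
    also have "\<dots> = proj_point J (g z)" using b by (intro proj_point_scale) auto
    finally show ?thesis using * J[OF z] b by auto
  qed
  have \<phi>: "\<phi> (proj_point J' (f z)) = proj_point J (g z)" if "z \<in> T" for z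
    using val[OF that someI[of "\<lambda>v. v \<in> proj_point J' (f z)", OF restrict_in_proj_point]]
    by (simp add: \<phi>_def)
  have one: "form J' 0 (\<lambda>_. 1)" by (auto simp: form_def intro: poly_fun.const)
  have nv: "\<not> vanishes_at (\<lambda>_. 1) (proj_point J' v)" for v
    using vanishes_at_proj_point[OF one] by simp
  have "regular_map J' ((\<lambda>z. proj_point J' (f z)) ` T) J ((\<lambda>z. proj_point J (g z)) ` T) \<phi>"
    unfolding regular_map_def
  proof (intro conjI ballI)
    show "\<phi> ` (\<lambda>z. proj_point J' (f z)) ` T \<subseteq> (\<lambda>z. proj_point J (g z)) ` T" using \<phi> by auto
    have "\<forall>b\<in>?A. \<forall>v\<in>b. (\<exists>j\<in>J. F j v \<noteq> 0) \<and> \<phi> b = proj_point J (\<lambda>j. F j v)"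
    proof (intro ballI)
      fix b v assume "b \<in> ?A" and v: "v \<in> b"
      then obtain z where z: "z \<in> T" "b = proj_point J' (f z)" by blast
      show "(\<exists>j\<in>J. F j v \<noteq> 0) \<and> \<phi> b = proj_point J (\<lambda>j. F j v)"
        using val[OF z(1), of v] v \<phi>[OF z(1)] z(2) by metis
    qed
    moreover fix a assume "a \<in> ?A"
    then have "\<not> vanishes_at (\<lambda>_. 1) a" using nv by blast
    ultimately show "\<exists>e ga d F. form J' e ga \<and> \<not> vanishes_at ga a \<and> (\<forall>j\<in>J. form J' d (F j)) \<and>
        (\<forall>b\<in>?A. \<not> vanishes_at ga b \<longrightarrow> (\<forall>v\<in>b. (\<exists>j\<in>J. F j v \<noteq> 0) \<and> \<phi> b = proj_point J (\<lambda>j. F j v)))"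
      using one F by blast
  qed
  with \<phi> show ?thesis by blast
qed

lemma isomorphic_varieties_by_forms:
  assumes "\<And>j. j \<in> J \<Longrightarrow> form I d (F j)" and "\<And>i. i \<in> I \<Longrightarrow> form J e (G i)"
    and "\<And>z. z \<in> T \<Longrightarrow> \<exists>i\<in>I. f z i \<noteq> 0" and "\<And>z. z \<in> T \<Longrightarrow> \<exists>j\<in>J. g z j \<noteq> 0"
    and "\<And>z j. z \<in> T \<Longrightarrow> j \<in> J \<Longrightarrow> F j (f z) = g z j"
    and "\<And>z i. z \<in> T \<Longrightarrow> i \<in> I \<Longrightarrow> G i (g z) = f z i"
  shows "isomorphic_varieties I ((\<lambda>z. proj_point I (f z)) ` T) J ((\<lambda>z. proj_point J (g z)) ` T)"
proof -
  let ?A = "(\<lambda>z. proj_point I (f z)) ` T" and ?B = "(\<lambda>z. proj_point J (g z)) ` T"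
  have "\<exists>\<phi>. regular_map I ?A J ?B \<phi> \<and> (\<forall>z\<in>T. \<phi> (proj_point I (f z)) = proj_point J (g z))"
    by (rule regular_map_by_forms[OF assms(1) assms(4) assms(5)])
  then obtain \<phi> where \<phi>: "regular_map I ?A J ?B \<phi>"
    "\<And>z. z \<in> T \<Longrightarrow> \<phi> (proj_point I (f z)) = proj_point J (g z)" by blast
  have "\<exists>\<psi>. regular_map J ?B I ?A \<psi> \<and> (\<forall>z\<in>T. \<psi> (proj_point J (g z)) = proj_point I (f z))"
    by (rule regular_map_by_forms[OF assms(2) assms(3) assms(6)])
  then obtain \<psi> where \<psi>: "regular_map J ?B I ?A \<psi>"
    "\<And>z. z \<in> T \<Longrightarrow> \<psi> (proj_point J (g z)) = proj_point I (f z)" by blast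
  have "(\<forall>a\<in>?A. \<psi> (\<phi> a) = a) \<and> (\<forall>b\<in>?B. \<phi> (\<psi> b) = b)" by (simp add: \<phi>(2) \<psi>(2))
  with \<phi>(1) \<psi>(1) show ?thesis unfolding isomorphic_varieties_def by blast
qed

text \<open>This is how points of the excluded hyperplanes enter the Zariski closure; the argument only uses
  that the complement of a finite set is dense in the real line.\<close>

lemma form_vanishes_on_line:
  assumes f: "form I d f" and "finite T"
    and 0: "\<And>\<epsilon>. \<epsilon> \<notin> T \<Longrightarrow> f (\<gamma> \<epsilon>) = 0"
    and \<gamma>: "\<And>i. i \<in> I \<Longrightarrow> continuous_on UNIV (\<lambda>\<epsilon>::real. \<gamma> \<epsilon> i)"
  shows "f (\<gamma> \<epsilon>) = 0"
proof -
  have "continuous_on UNIV (\<lambda>\<epsilon>. f (\<gamma> \<epsilon>))"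
    using poly_fun_continuous[of f I UNIV \<gamma>] f \<gamma> by (simp add: form_def)
  then have "closed {\<epsilon>. f (\<gamma> \<epsilon>) = 0}" by (intro closed_Collect_eq continuous_on_const)
  moreover have "- T \<subseteq> {\<epsilon>. f (\<gamma> \<epsilon>) = 0}" using 0 by auto
  ultimately have "closure (- T) \<subseteq> {\<epsilon>. f (\<gamma> \<epsilon>) = 0}" by (rule closure_minimal[rotated])
  moreover have "closure (- T) = UNIV"
    using \<open>finite T\<close> by (simp add: closure_complement empty_interior_finite)
  ultimately show ?thesis by auto
qed


section \<open>Sums over strategy profiles of a Segre point\<close>

text \<open>The coordinates on the Segre variety for \<open>N\<close> singletons and \<open>l\<close> pairs, as functions of a chosen
  representative.\<close>

definition segre_coord ::
  "nat \<Rightarrow> nat \<Rightarrow> (nat \<Rightarrow> 2 \<Rightarrow> real) \<Rightarrow> (nat \<Rightarrow> 2 \<Rightarrow> 2 \<Rightarrow> real) \<Rightarrow> (nat \<Rightarrow> 2) \<Rightarrow> real" where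
  "segre_coord N l s t j =
     (\<Prod>i = 1..N. s i (j i)) * (\<Prod>r = 1..l. t r (j (N + 2 * r - 1)) (j (N + 2 * r)))"

lemma segre_eq: "segre (N + 2 * l) l s t = proj_point (profiles (N + 2 * l)) (segre_coord N l s t)"
  by (simp add: segre_def segre_coord_def[abs_def])

lemma finite_profiles: "finite (profiles n)"
  by (simp add: profiles_def finite_PiE)

lemma pair_players_inj:
  assumes "r \<ge> 1" "r' \<ge> (1::nat)"
  shows "N + 2 * r - 1 \<noteq> N + 2 * r'" "N + 2 * r - 1 = N + 2 * r' - 1 \<longleftrightarrow> r = r'"
  using assms by presburger+

text \<open>Expanding the product on the right yields one summand for each choice of an entry in every factor;
  such a choice is the same as a strategy profile.\<close>

lemma sum_segre_coord:
  "(\<Sum>j\<in>profiles (N + 2 * l). segre_coord N l s t j) =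
     (\<Prod>i = 1..N. \<Sum>a\<in>UNIV. s i a) * (\<Prod>r = 1..l. \<Sum>a\<in>UNIV. \<Sum>b\<in>UNIV. t r a b)"
proof -
  let ?A = "{1..N} \<rightarrow>\<^sub>E (UNIV :: 2 set)" and ?B = "{1..l} \<rightarrow>\<^sub>E (UNIV :: (2 \<times> 2) set)"
  \<comment> \<open>A profile is split into the choices of the singletons and the pairs of choices, and merged back.\<close>
  define split where "split j = (restrict j {1..N}, \<lambda>r\<in>{1..l}. (j (N + 2 * r - 1), j (N + 2 * r)))"
    for j :: "nat \<Rightarrow> 2"
  define merge where "merge p = (\<lambda>k\<in>{1..N + 2 * l}. if k \<le> N then fst p k
      else if odd (k - N) then fst (snd p ((k - N + 1) div 2)) else snd (snd p ((k - N) div 2)))"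
    for p :: "(nat \<Rightarrow> 2) \<times> (nat \<Rightarrow> 2 \<times> 2)"
  have "(\<Sum>j\<in>profiles (N + 2 * l). segre_coord N l s t j) =
      (\<Sum>(f, g)\<in>?A \<times> ?B. (\<Prod>i = 1..N. s i (f i)) * (\<Prod>r = 1..l. t r (fst (g r)) (snd (g r))))"
  proof (rule sum.reindex_bij_witness[where i = merge and j = split])
    fix j assume j: "j \<in> profiles (N + 2 * l)"
    show "merge (split j) = j"
    proof
      fix k
      show "merge (split j) k = j k"
      proof (cases "k \<in> {1..N + 2 * l}")
        case False
        then show ?thesis using j by (auto simp: merge_def profiles_def PiE_def extensional_def)
      next
        case True
        show ?thesis
        proof (cases "k \<le> N")
          case True
          then show ?thesis using \<open>k \<in> {1..N + 2 * l}\<close> by (auto simp: merge_def split_def)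
        next
          case False
          define d where "d = k - N"
          have d: "k = N + d" "d \<ge> 1" "d \<le> 2 * l"
            using True False by (auto simp: d_def)
          show ?thesis
          proof (cases "odd d")
            case True
            then obtain e where e: "d = 2 * e + 1" by (elim oddE)
            then show ?thesis using d by (auto simp: merge_def split_def)
          next
            case False
            then obtain e where e: "d = 2 * e" by auto
            then show ?thesis using d by (auto simp: merge_def split_def)
          qed
        qed
      qed
    qed
    show "split j \<in> ?A \<times> ?B" by (auto simp: split_def)
    show "(case split j of (f, g) \<Rightarrow> (\<Prod>i = 1..N. s i (f i)) * (\<Prod>r = 1..l. t r (fst (g r)) (snd (g r))))
        = segre_coord N l s t j"
      by (simp add: split_def segre_coord_def)
  next
    fix p assume p: "p \<in> ?A \<times> ?B"
    obtain f g where fg: "p = (f, g)" "f \<in> ?A" "g \<in> ?B" using p by auto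
    show "merge p \<in> profiles (N + 2 * l)" by (auto simp: merge_def profiles_def)
    have "restrict (merge p) {1..N} = f"
      using fg by (auto simp: merge_def restrict_def PiE_def extensional_def fun_eq_iff)
    moreover have "(\<lambda>r\<in>{1..l}. (merge p (N + 2 * r - 1), merge p (N + 2 * r))) = g"
    proof
      fix r
      show "(\<lambda>r\<in>{1..l}. (merge p (N + 2 * r - 1), merge p (N + 2 * r))) r = g r"
      proof (cases "r \<in> {1..l}")
        case False
        then show ?thesis using fg by (auto simp: PiE_def extensional_def)
      next
        case True
        then obtain e where e: "r = Suc e" "Suc e \<le> l" by (cases r) auto
        then show ?thesis using fg by (auto simp: merge_def)
      qed
    qed
    ultimately show "split (merge p) = p" by (simp add: split_def fg)
  qed
  also have "\<dots> = (\<Sum>f\<in>?A. \<Prod>i = 1..N. s i (f i)) * (\<Sum>g\<in>?B. \<Prod>r = 1..l. t r (fst (g r)) (snd (g r)))"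
    by (simp add: sum_product sum.cartesian_product)
  also have "\<dots> = (\<Prod>i = 1..N. \<Sum>a\<in>UNIV. s i a) * (\<Prod>r = 1..l. \<Sum>p\<in>UNIV. t r (fst p) (snd p))"
    by (simp add: prod_sum_PiE)
  also have "(\<lambda>r. \<Sum>p\<in>UNIV. t r (fst p) (snd p)) = (\<lambda>r. \<Sum>a\<in>UNIV. \<Sum>b\<in>UNIV. t r a b)"
    by (simp add: sum.cartesian_product split_beta)
  finally show ?thesis .
qed

lemma prod_fun_upd:
  assumes "finite A" and "r \<in> A"
  shows "(\<Prod>q\<in>A. f q ((t(r := u)) q)) = f r u * (\<Prod>q\<in>A - {r}. f q (t q))"
proof -
  have "(\<Prod>q\<in>A - {r}. f q ((t(r := u)) q)) = (\<Prod>q\<in>A - {r}. f q (t q))"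
    by (rule prod.cong) auto
  then show ?thesis using prod.remove[OF assms, of "\<lambda>q. f q ((t(r := u)) q)"] by simp
qed

text \<open>A weight that depends on the choices of one pair only is absorbed by the coordinates of that pair.
  Both rows of each matrix \<open>M\<^sub>i\<close> are thereby reduced to total sums of points of the Segre variety.\<close>

lemma segre_coord_upd_pair:
  assumes "r \<in> {1..l}"
  shows "segre_coord N l s (t(r := \<lambda>a b. h a b * t r a b)) j =
    h (j (N + 2 * r - 1)) (j (N + 2 * r)) * segre_coord N l s t j"
proof -
  let ?f = "\<lambda>r u. u (j (N + 2 * r - 1)) (j (N + 2 * r))"
  have "(\<Prod>q\<in>{1..l}. ?f q ((t(r := \<lambda>a b. h a b * t r a b)) q)) =
      h (j (N + 2 * r - 1)) (j (N + 2 * r)) * (\<Prod>q\<in>{1..l}. ?f q (t q))"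
    unfolding prod_fun_upd[OF finite_atLeastAtMost assms, where f = ?f]
    by (subst prod.remove[OF finite_atLeastAtMost assms]) (simp only: mult.assoc)
  then show ?thesis unfolding segre_coord_def by (simp only: mult.left_commute)
qed

lemma segre_coord_upd_singleton:
  assumes "i \<in> {1..N}"
  shows "segre_coord N l (s(i := \<lambda>a. h a * s i a)) t j = h (j i) * segre_coord N l s t j"
proof -
  let ?f = "\<lambda>i u. u (j i)"
  have "(\<Prod>k\<in>{1..N}. ?f k ((s(i := \<lambda>a. h a * s i a)) k)) = h (j i) * (\<Prod>k\<in>{1..N}. ?f k (s k))"
    unfolding prod_fun_upd[OF finite_atLeastAtMost assms, where f = ?f]
    by (subst prod.remove[OF finite_atLeastAtMost assms]) (simp only: mult.assoc)
  then show ?thesis unfolding segre_coord_def by (simp only: mult.assoc)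
qed

lemma sum_segre_coord_weighted_pair:
  assumes "r \<in> {1..l}"
  shows "(\<Sum>j\<in>profiles (N + 2 * l). h (j (N + 2 * r - 1)) (j (N + 2 * r)) * segre_coord N l s t j) =
    (\<Sum>a\<in>UNIV. \<Sum>b\<in>UNIV. h a b * t r a b) *
      ((\<Prod>i = 1..N. \<Sum>a\<in>UNIV. s i a) * (\<Prod>q\<in>{1..l} - {r}. \<Sum>a\<in>UNIV. \<Sum>b\<in>UNIV. t q a b))"
proof -
  have "(\<Sum>j\<in>profiles (N + 2 * l). h (j (N + 2 * r - 1)) (j (N + 2 * r)) * segre_coord N l s t j) =
      (\<Sum>j\<in>profiles (N + 2 * l). segre_coord N l s (t(r := \<lambda>a b. h a b * t r a b)) j)"
    by (rule sum.cong[OF refl], rule segre_coord_upd_pair[OF assms, symmetric])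
  also have "\<dots> = (\<Prod>i = 1..N. \<Sum>a\<in>UNIV. s i a) *
      ((\<Sum>a\<in>UNIV. \<Sum>b\<in>UNIV. h a b * t r a b) * (\<Prod>q\<in>{1..l} - {r}. \<Sum>a\<in>UNIV. \<Sum>b\<in>UNIV. t q a b))"
    unfolding sum_segre_coord
      prod_fun_upd[OF finite_atLeastAtMost assms, where f = "\<lambda>q u. \<Sum>a\<in>UNIV. \<Sum>b\<in>UNIV. u a b"] ..
  finally show ?thesis by (simp only: mult.left_commute)
qed

lemma sum_segre_coord_weighted_singleton:
  assumes "i \<in> {1..N}"
  shows "(\<Sum>j\<in>profiles (N + 2 * l). h (j i) * segre_coord N l s t j) =
    (\<Sum>a\<in>UNIV. h a * s i a) *
      ((\<Prod>k\<in>{1..N} - {i}. \<Sum>a\<in>UNIV. s k a) * (\<Prod>q = 1..l. \<Sum>a\<in>UNIV. \<Sum>b\<in>UNIV. t q a b))"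
proof -
  have "(\<Sum>j\<in>profiles (N + 2 * l). h (j i) * segre_coord N l s t j) =
      (\<Sum>j\<in>profiles (N + 2 * l). segre_coord N l (s(i := \<lambda>a. h a * s i a)) t j)"
    by (rule sum.cong[OF refl], rule segre_coord_upd_singleton[OF assms, symmetric])
  also have "\<dots> = ((\<Sum>a\<in>UNIV. h a * s i a) * (\<Prod>k\<in>{1..N} - {i}. \<Sum>a\<in>UNIV. s k a)) *
      (\<Prod>q = 1..l. \<Sum>a\<in>UNIV. \<Sum>b\<in>UNIV. t q a b)"
    unfolding sum_segre_coord
      prod_fun_upd[OF finite_atLeastAtMost assms, where f = "\<lambda>q u. \<Sum>a\<in>UNIV. u a"] ..
  finally show ?thesis by (simp only: mult.assoc)
qed



section \<open>The game\<close>

text \<open>For a set \<open>A\<close> of singletons, the coordinate \<open>p\<^sub>j\<close> at this profile restricts to the monomial with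
  support \<open>A\<close> on the chart.\<close>

definition choice_profile :: "nat \<Rightarrow> nat set \<Rightarrow> nat \<Rightarrow> 2" where
  "choice_profile n A = (\<lambda>k\<in>{1..n}. if k \<in> A then 1 else 2)"

lemma choice_profile_in_profiles: "choice_profile n A \<in> profiles n"
  by (simp add: choice_profile_def profiles_def)

text \<open>Representatives adapted to the chart \<open>\<sigma>\<^sub>2 \<noteq> 0\<close>, \<open>\<sigma>\<^sub>2\<^sub>2 \<noteq> 0\<close>.\<close>

definition normalized :: "nat \<Rightarrow> nat \<Rightarrow> (nat \<Rightarrow> 2 \<Rightarrow> real) \<Rightarrow> (nat \<Rightarrow> 2 \<Rightarrow> 2 \<Rightarrow> real) \<Rightarrow> bool" where
  "normalized N l s t \<longleftrightarrow> (\<forall>i\<in>{1..N}. s i 2 = 1) \<and> (\<forall>r\<in>{1..l}. t r 2 2 = 1)"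

lemma segre_coord_singletons:
  assumes "normalized N l s t" and "A \<subseteq> {1..N}"
  shows "segre_coord N l s t (choice_profile (N + 2 * l) A) = (\<Prod>i\<in>A. s i 1)"
proof -
  let ?j = "choice_profile (N + 2 * l) A"
  have "(\<Prod>r = 1..l. t r (?j (N + 2 * r - 1)) (?j (N + 2 * r))) = 1"
  proof (rule prod.neutral, intro ballI)
    fix r assume r: "r \<in> {1..l}"
    then have k: "N + 2 * r - 1 \<in> {1..N + 2 * l} - {1..N}" "N + 2 * r \<in> {1..N + 2 * l} - {1..N}"
      by auto
    then have "N + 2 * r - 1 \<notin> A" "N + 2 * r \<notin> A" using assms(2) by blast+
    then have "?j (N + 2 * r - 1) = 2" "?j (N + 2 * r) = 2"
      using k by (simp_all only: choice_profile_def restrict_apply Diff_iff if_True if_False)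
    then show "t r (?j (N + 2 * r - 1)) (?j (N + 2 * r)) = 1"
      using assms(1) r by (simp only: normalized_def)
  qed
  moreover have "(\<Prod>i = 1..N. s i (?j i)) = (\<Prod>i = 1..N. if i \<in> A then s i 1 else 1)"
    using assms(1) by (intro prod.cong) (auto simp: choice_profile_def normalized_def)
  moreover have "\<dots> = (\<Prod>i\<in>A. s i 1)"
    using assms(2) by (subst prod.inter_restrict[symmetric]) (auto simp: Int_absorb1)
  ultimately show ?thesis by (simp add: segre_coord_def)
qed

lemma segre_coord_pair:
  assumes "normalized N l s t" and r: "r \<in> {1..l}"
    and j: "\<And>k. k \<in> {1..N + 2 * l} \<Longrightarrow> k \<noteq> N + 2 * r - 1 \<Longrightarrow> k \<noteq> N + 2 * r \<Longrightarrow> j k = 2"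
  shows "segre_coord N l s t j = t r (j (N + 2 * r - 1)) (j (N + 2 * r))"
proof -
  have "(\<Prod>i = 1..N. s i (j i)) = 1"
  proof (rule prod.neutral, intro ballI)
    fix i assume i: "i \<in> {1..N}"
    then have "j i = 2" using r by (intro j) auto
    then show "s i (j i) = 1" using assms(1) i by (simp only: normalized_def)
  qed
  moreover have "(\<Prod>q\<in>{1..l} - {r}. t q (j (N + 2 * q - 1)) (j (N + 2 * q))) = 1"
  proof (rule prod.neutral, intro ballI)
    fix q assume q: "q \<in> {1..l} - {r}"
    then have "N + 2 * q - 1 \<noteq> N + 2 * r - 1 \<and> N + 2 * q - 1 \<noteq> N + 2 * r \<and>
        N + 2 * q \<noteq> N + 2 * r - 1 \<and> N + 2 * q \<noteq> N + 2 * r"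
      using pair_players_inj[of q r N] pair_players_inj[of r q N] r by auto
    then have "j (N + 2 * q - 1) = 2" "j (N + 2 * q) = 2"
      using q by (auto intro!: j)
    then show "t q (j (N + 2 * q - 1)) (j (N + 2 * q)) = 1"
      using assms(1) q by (simp only: normalized_def Diff_iff)
  qed
  ultimately show ?thesis
    unfolding segre_coord_def
    using prod.remove[OF finite_atLeastAtMost r, of "\<lambda>q. t q (j (N + 2 * q - 1)) (j (N + 2 * q))"]
    by simp
qed

text \<open>The payoffs are the coefficients of \<open>F\<close>, placed at profiles in which all pairs make the second
  choice. Since \<open>F\<close> does not involve the coordinate of player \<open>i\<close>, only profiles in which \<open>i\<close> makes
  the second choice are used.\<close>

lemma multiaffine_payoffs:
  assumes "F \<in> multiaffine ({1..N} - {i})" and i: "i \<in> {1..N}"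
  shows "\<exists>Y. (\<forall>j. j i = 1 \<longrightarrow> Y j = 0) \<and> (\<forall>s t. normalized N l s t \<longrightarrow>
    (\<Sum>j\<in>profiles (N + 2 * l). Y j * segre_coord N l s t j) = F (\<lambda>v. s v 1))"
  using assms(1)
proof (induction rule: multiaffine.induct)
  case (monomial A c)
  let ?e = "choice_profile (N + 2 * l) A"
  let ?Y = "\<lambda>j. if j = ?e then c else 0"
  have "?e i = 2" using monomial i by (auto simp: choice_profile_def)
  then have "\<forall>j. j i = 1 \<longrightarrow> ?Y j = 0" by auto
  moreover have "(\<Sum>j\<in>profiles (N + 2 * l). ?Y j * segre_coord N l s t j) = c * (\<Prod>v\<in>A. s v 1)"
    if "normalized N l s t" for s t
  proof -
    have "A \<subseteq> {1..N}" using monomial by blast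
    have "(\<Sum>j\<in>profiles (N + 2 * l). ?Y j * segre_coord N l s t j) =
        (\<Sum>j\<in>profiles (N + 2 * l). if j = ?e then c * segre_coord N l s t ?e else 0)"
      by (rule sum.cong) auto
    then show ?thesis
      using segre_coord_singletons[OF that \<open>A \<subseteq> {1..N}\<close>]
      by (simp add: finite_profiles choice_profile_in_profiles)
  qed
  ultimately show ?case by (intro exI[of _ ?Y]) blast
next
  case (add f g)
  then obtain Y Z where "\<forall>j. j i = 1 \<longrightarrow> Y j = 0" "\<forall>j. j i = 1 \<longrightarrow> Z j = 0"
    and "\<And>s t. normalized N l s t \<Longrightarrow>
      (\<Sum>j\<in>profiles (N + 2 * l). Y j * segre_coord N l s t j) = f (\<lambda>v. s v 1)"
    and "\<And>s t. normalized N l s t \<Longrightarrow>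
      (\<Sum>j\<in>profiles (N + 2 * l). Z j * segre_coord N l s t j) = g (\<lambda>v. s v 1)" by blast
  then show ?case
    by (intro exI[of _ "\<lambda>j. Y j + Z j"]) (simp add: distrib_right sum.distrib)
qed

text \<open>Parity distinguishes the first and the second player of a pair. The payoffs of both only depend on
  the choices in the pair, so that the other players contribute a nonzero factor to their
  determinants.\<close>

definition realizing_game :: "nat \<Rightarrow> game \<Rightarrow> game" where
  "realizing_game N Y i j =
     (if i \<le> N then Y i j
      else if odd (i - N) then of_bool (j (i + 1) = 2)
      else of_bool (j (i - 1) \<noteq> j i))"

lemma det_spohn_matrix:
  "det (spohn_matrix n X i p) =
     (\<Sum>j\<in>profiles n. of_bool (j i = 1) * p j) * (\<Sum>j\<in>profiles n. of_bool (j i = 2) * X i j * p j) -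
     (\<Sum>j\<in>profiles n. of_bool (j i = 1) * X i j * p j) * (\<Sum>j\<in>profiles n. of_bool (j i = 2) * p j)"
proof -
  have "(\<Sum>j | j \<in> profiles n \<and> j i = a. f j) = (\<Sum>j\<in>profiles n. of_bool (j i = a) * f j)"
    for a :: 2 and f :: "(nat \<Rightarrow> 2) \<Rightarrow> real"
    by (simp add: sum.inter_filter[OF finite_profiles] if_distrib[symmetric] of_bool_def
        cong: sum.cong if_cong) (auto intro: sum.cong)
  then show ?thesis by (simp add: det_2 spohn_matrix_def vector_2 mult.assoc)
qed

lemma form_det_spohn_matrix: "form (profiles n) 2 (\<lambda>p. det (spohn_matrix n X i p))"
  unfolding det_spohn_matrix one_add_one[symmetric]
  by (intro form_diff form_mult form_linear subset_refl)

lemma det_singleton: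
  assumes "i \<in> {1..N}" and "\<And>j. j i = 1 \<Longrightarrow> Y i j = 0"
  shows "det (spohn_matrix n (realizing_game N Y) i p) =
    (\<Sum>j\<in>profiles n. of_bool (j i = 1) * p j) * (\<Sum>j\<in>profiles n. Y i j * p j)"
proof -
  have X: "realizing_game N Y i = Y i" using assms(1) by (simp add: realizing_game_def[abs_def])
  have *: "of_bool (j i = 1) * Y i j * p j = 0" "of_bool (j i = 2) * Y i j * p j = Y i j * p j" for j
    using assms(2) exhaust_2[of "j i"] by auto
  then show ?thesis unfolding det_spohn_matrix X * by simp
qed

text \<open>In homogeneous coordinates, the first determinant expresses that the matrix of the pair has rank
  at most one; together with the second, it will force the rows to be equal.\<close>

lemma det_pair:
  fixes N l r :: nat and s t
  assumes r: "r \<in> {1..l}"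
  defines "R \<equiv> (\<Prod>i = 1..N. \<Sum>a\<in>UNIV. s i a) * (\<Prod>q\<in>{1..l} - {r}. \<Sum>a\<in>UNIV. \<Sum>b\<in>UNIV. t q a b)"
  shows "det (spohn_matrix (N + 2 * l) (realizing_game N Y) (N + 2 * r - 1) (segre_coord N l s t)) =
      R\<^sup>2 * (t r 1 1 * t r 2 2 - t r 1 2 * t r 2 1)"
    and "det (spohn_matrix (N + 2 * l) (realizing_game N Y) (N + 2 * r) (segre_coord N l s t)) =
      R\<^sup>2 * (t r 1 1 * t r 1 2 - t r 2 1 * t r 2 2)"
proof -
  let ?h = "\<lambda>h j. h (j (N + 2 * r - 1)) (j (N + 2 * r)) :: real"
  have sum: "(\<Sum>j\<in>profiles (N + 2 * l). ?h h j * segre_coord N l s t j) =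
      (h 1 1 * t r 1 1 + h 1 2 * t r 1 2 + (h 2 1 * t r 2 1 + h 2 2 * t r 2 2)) * R" for h
    unfolding sum_segre_coord_weighted_pair[OF r] R_def[symmetric] by (simp add: sum_2)
  have odd: "realizing_game N Y (N + 2 * r - 1) j = of_bool (j (N + 2 * r) = 2)" for j
    using r by (auto simp: realizing_game_def)
  have even: "realizing_game N Y (N + 2 * r) j = of_bool (j (N + 2 * r - 1) \<noteq> j (N + 2 * r))" for j
    using r by (auto simp: realizing_game_def)
  show "det (spohn_matrix (N + 2 * l) (realizing_game N Y) (N + 2 * r - 1) (segre_coord N l s t)) =
      R\<^sup>2 * (t r 1 1 * t r 2 2 - t r 1 2 * t r 2 1)"
    unfolding det_spohn_matrix odd
    using sum[of "\<lambda>a b. of_bool (a = 1)"] sum[of "\<lambda>a b. of_bool (a = 2)"]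
      sum[of "\<lambda>a b. of_bool (a = 1) * of_bool (b = 2)"] sum[of "\<lambda>a b. of_bool (a = 2) * of_bool (b = 2)"]
    by (simp add: power2_eq_square algebra_simps)
  show "det (spohn_matrix (N + 2 * l) (realizing_game N Y) (N + 2 * r) (segre_coord N l s t)) =
      R\<^sup>2 * (t r 1 1 * t r 1 2 - t r 2 1 * t r 2 2)"
    unfolding det_spohn_matrix even
    using sum[of "\<lambda>a b. of_bool (b = 1)"] sum[of "\<lambda>a b. of_bool (b = 2)"]
      sum[of "\<lambda>a b. of_bool (b = 1) * of_bool (a \<noteq> b)"] sum[of "\<lambda>a b. of_bool (b = 2) * of_bool (a \<noteq> b)"]
    by (simp add: power2_eq_square algebra_simps)
qed

text \<open>The equations give \<open>b\<^sup>2 = d\<^sup>2\<close>; the solution \<open>d = - b\<close> also has \<open>c = - a\<close>, and is excluded because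
  the entries sum to \<open>0\<close>.\<close>

lemma pair_line:
  fixes a b c d :: real
  assumes "a \<noteq> 0" "b \<noteq> 0" "c \<noteq> 0" "d \<noteq> 0" "a + b + (c + d) \<noteq> 0"
    and 1: "a * d = b * c" and 2: "a * b = c * d"
  shows "a = c \<and> b = d"
proof -
  have "a * d\<^sup>2 = a * b\<^sup>2" using 1 2 by (metis mult.assoc mult.commute power2_eq_square)
  then have "d\<^sup>2 = b\<^sup>2" using assms by simp
  then consider "d = b" | "d = - b" by (auto simp: power2_eq_iff)
  then show ?thesis
  proof cases
    case 1
    then show ?thesis using 2 assms by simp
  next
    case 2
    then have "b * (a + c) = 0" using \<open>a * b = c * d\<close> by (simp add: algebra_simps)
    then have "a + b + (c + d) = 0" using 2 assms by simp
    then show ?thesis using assms by simp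
  qed
qed


section \<open>The Nash conditional independence variety of the game\<close>

lemma in_excluded_hyperplanes:
  assumes "proj_point (profiles n) p \<in> proj_space (profiles n)"
  shows "proj_point (profiles n) p \<in> excluded_hyperplanes n \<longleftrightarrow>
    (\<exists>j\<in>profiles n. p j = 0) \<or> (\<Sum>j\<in>profiles n. p j) = 0"
proof -
  have "form (profiles n) 1 (\<lambda>p. \<Sum>j\<in>profiles n. p j)"
    using form_linear[of "profiles n" "profiles n" "\<lambda>_. 1"] by simp
  then show ?thesis using assms
    by (auto simp: excluded_hyperplanes_def vanishes_at_proj_point[OF form_coord]
        vanishes_at_proj_point)
qed

lemma in_spohn_variety:
  "proj_point (profiles n) p \<in> spohn_variety n X \<longleftrightarrow>
     proj_point (profiles n) p \<in> proj_space (profiles n) \<and>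
     (\<forall>i\<in>{1..n}. det (spohn_matrix n X i p) = 0)"
  by (simp add: spohn_variety_def vanishes_at_proj_point[OF form_det_spohn_matrix])

lemma segre_factors_nonzero:
  assumes p: "\<And>j. j \<in> profiles (N + 2 * l) \<Longrightarrow> segre_coord N l s t j \<noteq> 0"
  shows "i \<in> {1..N} \<Longrightarrow> s i a \<noteq> 0" and "r \<in> {1..l} \<Longrightarrow> t r a b \<noteq> 0"
proof -
  assume i: "i \<in> {1..N}"
  let ?j = "\<lambda>k\<in>{1..N + 2 * l}. a"
  have "segre_coord N l s t ?j \<noteq> 0" by (rule p) (simp add: profiles_def)
  then have "s i (?j i) \<noteq> 0" using i by (simp add: segre_coord_def)
  then show "s i a \<noteq> 0" using i by simp
next
  assume r: "r \<in> {1..l}"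
  let ?j = "\<lambda>k\<in>{1..N + 2 * l}. if k = N + 2 * r - 1 then a else b"
  have "segre_coord N l s t ?j \<noteq> 0" by (rule p) (simp add: profiles_def)
  then have "t r (?j (N + 2 * r - 1)) (?j (N + 2 * r)) \<noteq> 0"
    using r by (simp add: segre_coord_def)
  moreover have "?j (N + 2 * r - 1) = a" "?j (N + 2 * r) = b" using r by auto
  ultimately show "t r a b \<noteq> 0" by simp
qed

lemma players_cases:
  fixes i N l :: nat
  assumes "i \<in> {1..N + 2 * l}"
  obtains "i \<in> {1..N}" | r where "r \<in> {1..l}" "i = N + 2 * r - 1" | r where "r \<in> {1..l}" "i = N + 2 * r"
proof (cases "i \<le> N")
  case True
  with assms that(1) show ?thesis by auto
next
  case False
  define d where "d = i - N"
  have d: "i = N + d" "d \<ge> 1" "d \<le> 2 * l" using False assms by (auto simp: d_def)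
  show ?thesis
  proof (cases "even d")
    case True
    then obtain r where "d = 2 * r" by auto
    with d show ?thesis by (intro that(3)[of r]) auto
  next
    case False
    then obtain r where "d = 2 * r + 1" by (elim oddE)
    with d show ?thesis by (intro that(2)[of "r + 1"]) auto
  qed
qed

text \<open>Together the following two functions parametrize, by \<open>y\<close> and \<open>c\<close>, the points of the chart
  in which the two rows of each pair agree: the singleton \<open>i\<close> has coordinates \<open>(y i, 1)\<close>, and both
  rows of pair \<open>r\<close> are \<open>(c r, 1)\<close>.\<close>

definition singleton_coords :: "(nat \<Rightarrow> real) \<Rightarrow> nat \<Rightarrow> 2 \<Rightarrow> real" where
  "singleton_coords y i a = (if a = 1 then y i else 1)"

definition pair_coords :: "(nat \<Rightarrow> real) \<Rightarrow> nat \<Rightarrow> 2 \<Rightarrow> 2 \<Rightarrow> real" where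
  "pair_coords c r a b = (if b = 1 then c r else 1)"

abbreviation line_coord :: "nat \<Rightarrow> nat \<Rightarrow> (nat \<Rightarrow> real) \<Rightarrow> (nat \<Rightarrow> real) \<Rightarrow> (nat \<Rightarrow> 2) \<Rightarrow> real" where
  "line_coord N l y c \<equiv> segre_coord N l (singleton_coords y) (pair_coords c)"

lemma normalized_line: "normalized N l (singleton_coords y) (pair_coords c)"
  by (simp add: normalized_def singleton_coords_def pair_coords_def)

text \<open>Off the excluded hyperplanes, the quadratic equations of the Spohn variety become linear in the
  coordinates of the ambient projective space; this is what controls the Zariski closure.\<close>

lemma generic_point_equations:
  fixes Y :: game
  assumes Y: "\<forall>i\<in>{1..N}. \<forall>j. j i = 1 \<longrightarrow> Y i j = 0"
    and p: "\<forall>j\<in>profiles (N + 2 * l). segre_coord N l s t j \<noteq> 0"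
    and total: "(\<Sum>j\<in>profiles (N + 2 * l). segre_coord N l s t j) \<noteq> 0"
  shows "(\<forall>i\<in>{1..N + 2 * l}. det (spohn_matrix (N + 2 * l) (realizing_game N Y) i (segre_coord N l s t)) = 0)
    \<longleftrightarrow> (\<forall>i\<in>{1..N}. (\<Sum>j\<in>profiles (N + 2 * l). Y i j * segre_coord N l s t j) = 0) \<and>
        (\<forall>r\<in>{1..l}. \<forall>b. t r 1 b = t r 2 b)"
proof -
  let ?p = "segre_coord N l s t" and ?J = "profiles (N + 2 * l)"
  let ?D = "\<lambda>i. det (spohn_matrix (N + 2 * l) (realizing_game N Y) i (segre_coord N l s t))"
  have S: "(\<Sum>a\<in>UNIV. s i a) \<noteq> 0" if "i \<in> {1..N}" for i
    using total that unfolding sum_segre_coord by auto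
  have T: "(\<Sum>a\<in>UNIV. \<Sum>b\<in>UNIV. t r a b) \<noteq> 0" if "r \<in> {1..l}" for r
    using total that unfolding sum_segre_coord by auto
  have single: "?D i = 0 \<longleftrightarrow> (\<Sum>j\<in>?J. Y i j * ?p j) = 0" if i: "i \<in> {1..N}" for i
  proof -
    have "(\<Sum>j\<in>?J. of_bool (j i = 1) * ?p j) = s i 1 *
        ((\<Prod>k\<in>{1..N} - {i}. \<Sum>a\<in>UNIV. s k a) * (\<Prod>q = 1..l. \<Sum>a\<in>UNIV. \<Sum>b\<in>UNIV. t q a b))"
      using sum_segre_coord_weighted_singleton[OF i, of "\<lambda>a. of_bool (a = 1)"] by (simp add: sum_2)
    moreover have "s i 1 \<noteq> 0" using segre_factors_nonzero(1)[OF bspec[OF p] i] .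
    moreover have "(\<Prod>k\<in>{1..N} - {i}. \<Sum>a\<in>UNIV. s k a) \<noteq> 0"
      using S by simp
    moreover have "(\<Prod>q = 1..l. \<Sum>a\<in>UNIV. \<Sum>b\<in>UNIV. t q a b) \<noteq> 0"
      using T by simp
    ultimately have "(\<Sum>j\<in>?J. of_bool (j i = 1) * ?p j) \<noteq> 0" by simp
    moreover have "?D i = (\<Sum>j\<in>?J. of_bool (j i = 1) * ?p j) * (\<Sum>j\<in>?J. Y i j * ?p j)"
      by (rule det_singleton[OF i]) (use Y i in blast)
    ultimately show ?thesis by simp
  qed
  have pair: "?D (N + 2 * r - 1) = 0 \<and> ?D (N + 2 * r) = 0 \<longleftrightarrow> (\<forall>b. t r 1 b = t r 2 b)"
    if r: "r \<in> {1..l}" for r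
  proof -
    have R: "(\<Prod>i = 1..N. \<Sum>a\<in>UNIV. s i a) * (\<Prod>q\<in>{1..l} - {r}. \<Sum>a\<in>UNIV. \<Sum>b\<in>UNIV. t q a b) \<noteq> 0"
      using S T by simp
    have "?D (N + 2 * r - 1) = 0 \<and> ?D (N + 2 * r) = 0 \<longleftrightarrow>
        t r 1 1 * t r 2 2 = t r 1 2 * t r 2 1 \<and> t r 1 1 * t r 1 2 = t r 2 1 * t r 2 2"
      unfolding det_pair[OF r] using R by simp
    also have "\<dots> \<longleftrightarrow> t r 1 1 = t r 2 1 \<and> t r 1 2 = t r 2 2"
    proof
      have "t r a b \<noteq> 0" for a b using segre_factors_nonzero(2)[OF bspec[OF p] r] .
      moreover have "t r 1 1 + t r 1 2 + (t r 2 1 + t r 2 2) \<noteq> 0" using T[OF r] by (simp add: sum_2)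
      moreover assume "t r 1 1 * t r 2 2 = t r 1 2 * t r 2 1 \<and> t r 1 1 * t r 1 2 = t r 2 1 * t r 2 2"
      ultimately show "t r 1 1 = t r 2 1 \<and> t r 1 2 = t r 2 2"
        using pair_line[of "t r 1 1" "t r 1 2" "t r 2 1" "t r 2 2"] by blast
    qed simp
    also have "\<dots> \<longleftrightarrow> (\<forall>b. t r 1 b = t r 2 b)" by (simp add: forall_2)
    finally show ?thesis .
  qed
  show ?thesis (is "?L \<longleftrightarrow> ?R")
  proof
    assume L: ?L
    have "(\<Sum>j\<in>?J. Y i j * ?p j) = 0" if "i \<in> {1..N}" for i
      using L single that by auto
    moreover have "\<forall>b. t r 1 b = t r 2 b" if r: "r \<in> {1..l}" for r
    proof -
      have "N + 2 * r - 1 \<in> {1..N + 2 * l}" "N + 2 * r \<in> {1..N + 2 * l}" using r by auto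
      then show ?thesis using L pair[OF r] by blast
    qed
    ultimately show ?R by blast
  next
    assume R: ?R
    show ?L
    proof
      fix i assume "i \<in> {1..N + 2 * l}"
      then show "?D i = 0" by (cases rule: players_cases) (use R single pair in blast)+
    qed
  qed
qed

lemma proj_point_in_proj_space: "i \<in> I \<Longrightarrow> v i \<noteq> 0 \<Longrightarrow> proj_point I v \<in> proj_space I"
  unfolding proj_space_def by blast

lemma segre_coord_cong:
  assumes "\<And>i a. i \<in> {1..N} \<Longrightarrow> s i a = s' i a" and "\<And>r a b. r \<in> {1..l} \<Longrightarrow> t r a b = t' r a b"
  shows "segre_coord N l s t = segre_coord N l s' t'"
  unfolding segre_coord_def using assms by (auto simp: fun_eq_iff intro!: arg_cong2[of _ _ _ _ "(*)"] prod.cong)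

lemma segre_normalize:
  assumes "\<forall>i\<in>{1..N}. s i 2 \<noteq> 0" and "\<forall>r\<in>{1..l}. t r 2 2 \<noteq> 0"
  shows "\<exists>s' t'. normalized N l s' t' \<and> segre (N + 2 * l) l s t = segre (N + 2 * l) l s' t'"
proof (intro exI conjI)
  let ?s = "\<lambda>i a. s i a / s i 2" and ?t = "\<lambda>r a b. t r a b / t r 2 2"
  show "normalized N l ?s ?t" using assms by (simp add: normalized_def)
  let ?K = "(\<Prod>i = 1..N. s i 2) * (\<Prod>r = 1..l. t r 2 2)"
  have K: "?K \<noteq> 0" using assms by simp
  have "segre_coord N l s t = (\<lambda>j. ?K * segre_coord N l ?s ?t j)"
    using K by (simp add: fun_eq_iff segre_coord_def prod_dividef)
  then show "segre (N + 2 * l) l s t = segre (N + 2 * l) l ?s ?t"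
    using proj_point_scale[OF K] by (simp add: segre_eq)
qed

text \<open>One inclusion holds because the conditions found off the excluded hyperplanes are given by linear
  forms and thus persist in the closure. For the other, every point is a limit of points off the
  excluded hyperplanes, along the line on which all \<open>c r\<close> grow by the same amount: by positivity of
  \<open>y\<close>, only the values \<open>c r = 0\<close> and \<open>c r = -1\<close> have to be avoided.\<close>

lemma nash_ci_open_realizing_game:
  fixes E :: "nat \<Rightarrow> (nat \<Rightarrow> real) \<Rightarrow> real"
  assumes E: "\<And>i. i \<in> {1..N} \<Longrightarrow> E i \<in> multiaffine ({1..N} - {i})"
    and pos: "\<And>y i. \<forall>i\<in>{1..N}. E i y = 0 \<Longrightarrow> i \<in> {1..N} \<Longrightarrow> y i > 0"
  shows "\<exists>X. nash_ci_open (N + 2 * l) l X =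
    {proj_point (profiles (N + 2 * l)) (line_coord N l y c) | y c. \<forall>i\<in>{1..N}. E i y = 0}"
proof -
  let ?n = "N + 2 * l" let ?J = "profiles ?n"
  have "\<forall>i\<in>{1..N}. \<exists>Y. (\<forall>j. j i = 1 \<longrightarrow> Y j = 0) \<and> (\<forall>s t. normalized N l s t \<longrightarrow>
      (\<Sum>j\<in>?J. Y j * segre_coord N l s t j) = E i (\<lambda>v. s v 1))"
    using multiaffine_payoffs[OF E] by blast
  then obtain Y where Y: "\<forall>i\<in>{1..N}. \<forall>j. j i = 1 \<longrightarrow> Y i j = 0"
    and YE: "\<And>i s t. i \<in> {1..N} \<Longrightarrow> normalized N l s t \<Longrightarrow>
      (\<Sum>j\<in>?J. Y i j * segre_coord N l s t j) = E i (\<lambda>v. s v 1)" by metis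
  define X where "X = realizing_game N Y"
  define A where "A = spohn_variety ?n X \<inter> independence_model ?n l - excluded_hyperplanes ?n"
  have A: "\<exists>s t. x = proj_point ?J (segre_coord N l s t) \<and>
      (\<forall>i\<in>{1..N}. (\<Sum>j\<in>?J. Y i j * segre_coord N l s t j) = 0) \<and> (\<forall>r\<in>{1..l}. \<forall>b. t r 1 b = t r 2 b)"
    if x: "x \<in> A" for x
  proof -
    obtain s t where st: "x = proj_point ?J (segre_coord N l s t)"
      using x by (auto simp: A_def independence_model_def segre_eq)
    have ps: "x \<in> proj_space ?J" and dets: "\<forall>i\<in>{1..?n}. det (spohn_matrix ?n X i (segre_coord N l s t)) = 0"
      using x in_spohn_variety unfolding A_def st by blast+
    have p: "\<forall>j\<in>?J. segre_coord N l s t j \<noteq> 0" and total: "(\<Sum>j\<in>?J. segre_coord N l s t j) \<noteq> 0"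
      using x in_excluded_hyperplanes ps unfolding A_def st by blast+
    then have "(\<forall>i\<in>{1..N}. (\<Sum>j\<in>?J. Y i j * segre_coord N l s t j) = 0) \<and> (\<forall>r\<in>{1..l}. \<forall>b. t r 1 b = t r 2 b)"
      using generic_point_equations[OF Y p total] dets unfolding X_def by blast
    with st show ?thesis by blast
  qed
  have mem: "proj_point ?J (line_coord N l y c) \<in> A"
    if y: "\<forall>i\<in>{1..N}. E i y = 0" and c: "\<And>r. r \<in> {1..l} \<Longrightarrow> c r \<noteq> 0 \<and> c r \<noteq> -1" for y c
  proof -
    let ?s = "singleton_coords y" and ?t = "pair_coords c"
    have ypos: "y i > 0" if "i \<in> {1..N}" for i using pos[OF y that] .
    have s0: "?s i a \<noteq> 0" if "i \<in> {1..N}" for i a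
      using ypos[OF that] by (simp add: singleton_coords_def)
    have t0: "?t r a b \<noteq> 0" if "r \<in> {1..l}" for r a b
      using c[OF that] by (simp add: pair_coords_def)
    have p: "line_coord N l y c j \<noteq> 0" for j
      using s0 t0 by (simp add: segre_coord_def)
    have ps: "proj_point ?J (line_coord N l y c) \<in> proj_space ?J"
      by (rule proj_point_in_proj_space[OF choice_profile_in_profiles p])
    have "(\<Sum>a\<in>UNIV. ?s i a) \<noteq> 0" if "i \<in> {1..N}" for i
      using ypos[OF that] by (simp add: sum_2 singleton_coords_def)
    moreover have "(\<Sum>a\<in>UNIV. \<Sum>b\<in>UNIV. ?t r a b) \<noteq> 0" if "r \<in> {1..l}" for r
      using c[OF that] by (simp add: sum_2 pair_coords_def)
    ultimately have total: "(\<Sum>j\<in>?J. line_coord N l y c j) \<noteq> 0"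
      unfolding sum_segre_coord by simp
    have "(\<Sum>j\<in>?J. Y i j * line_coord N l y c j) = 0" if "i \<in> {1..N}" for i
      using YE[OF that normalized_line] y that by (simp add: singleton_coords_def)
    moreover have "\<forall>r\<in>{1..l}. \<forall>b. ?t r 1 b = ?t r 2 b" by (simp add: pair_coords_def)
    ultimately have "\<forall>i\<in>{1..?n}. det (spohn_matrix ?n X i (line_coord N l y c)) = 0"
      using generic_point_equations[OF Y _ total] p unfolding X_def by blast
    then have "proj_point ?J (line_coord N l y c) \<in> spohn_variety ?n X"
      unfolding in_spohn_variety using ps by (rule conjI[rotated])
    moreover have "\<forall>i\<in>{1..?n - 2 * l}. \<exists>a. ?s i a \<noteq> 0" "\<forall>r\<in>{1..l}. \<exists>a b. ?t r a b \<noteq> 0"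
      using s0 t0 by simp_all
    then have "proj_point ?J (line_coord N l y c) \<in> independence_model ?n l"
      unfolding independence_model_def segre_eq[symmetric] by blast
    moreover have "proj_point ?J (line_coord N l y c) \<notin> excluded_hyperplanes ?n"
      using in_excluded_hyperplanes[OF ps] p total by blast
    ultimately show ?thesis by (simp add: A_def)
  qed
  have open_eq: "nash_ci_open ?n l X = {x \<in> zariski_closure ?J A. \<exists>s t. x = segre ?n l s t \<and>
      (\<forall>i\<in>{1..N}. s i 2 \<noteq> 0) \<and> (\<forall>r\<in>{1..l}. t r 2 2 \<noteq> 0)}"
    by (simp add: nash_ci_open_def nash_ci_variety_def A_def)
  have "nash_ci_open ?n l X = {proj_point ?J (line_coord N l y c) | y c. \<forall>i\<in>{1..N}. E i y = 0}"
  proof (intro equalityI subsetI)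
    fix x assume x: "x \<in> nash_ci_open ?n l X"
    then obtain s t where norm: "normalized N l s t" and st: "x = proj_point ?J (segre_coord N l s t)"
      using segre_normalize unfolding open_eq segre_eq by blast
    have vanish: "f (segre_coord N l s t) = 0" if "form ?J 1 f" "\<And>a. a \<in> A \<Longrightarrow> vanishes_at f a" for f
    proof -
      have "vanishes_at f x" using x that unfolding open_eq zariski_closure_def by blast
      then show ?thesis using vanishes_at_proj_point[OF that(1)] unfolding st by blast
    qed
    have solution: "\<forall>i\<in>{1..N}. E i (\<lambda>v. s v 1) = 0"
    proof
      fix i assume i: "i \<in> {1..N}"
      have form: "form ?J 1 (\<lambda>p. \<Sum>j\<in>?J. Y i j * p j)" by (rule form_linear) simp
      have "(\<Sum>j\<in>?J. Y i j * segre_coord N l s t j) = 0"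
      proof (rule vanish[OF form])
        fix a assume "a \<in> A"
        then show "vanishes_at (\<lambda>p. \<Sum>j\<in>?J. Y i j * p j) a"
          using A[of a] i vanishes_at_proj_point[OF form] by blast
      qed
      then show "E i (\<lambda>v. s v 1) = 0" using YE[OF i norm] by simp
    qed
    have rows: "t r 1 b = t r 2 b" if r: "r \<in> {1..l}" for r b
    proof -
      \<comment> \<open>Equality of the two rows of pair \<open>r\<close> means that the choice of the first player of the pair does
        not affect the coordinates \<open>p\<^sub>j\<close>.\<close>
      define j where "j = (choice_profile ?n {})(N + 2 * r := b)"
      let ?j1 = "j(N + 2 * r - 1 := 1)" and ?j2 = "j(N + 2 * r - 1 := 2)"
      have players: "N + 2 * r - 1 \<in> {1..?n}" "N + 2 * r \<in> {1..?n}" "N + 2 * r - 1 \<noteq> N + 2 * r"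
        using r by auto
      have j: "?j1 \<in> ?J" "?j2 \<in> ?J"
        using players by (auto simp: j_def choice_profile_def profiles_def PiE_def extensional_def)
      have form: "form ?J 1 (\<lambda>p. p ?j1 - p ?j2)" by (intro form_diff form_coord j)
      have "segre_coord N l s t ?j1 - segre_coord N l s t ?j2 = 0"
      proof (rule vanish[OF form])
        fix a assume "a \<in> A"
        then obtain s' t' where a: "a = proj_point ?J (segre_coord N l s' t')"
          and t': "\<forall>r\<in>{1..l}. \<forall>b. t' r 1 b = t' r 2 b" using A by blast
        have "s' i (?j1 i) = s' i (?j2 i)" if "i \<in> {1..N}" for i
          using that r by auto
        moreover have "t' q (?j1 (N + 2 * q - 1)) (?j1 (N + 2 * q)) = t' q (?j2 (N + 2 * q - 1)) (?j2 (N + 2 * q))"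
          if "q \<in> {1..l}" for q
          using that r t' pair_players_inj[of q r N] pair_players_inj[of r q N] by auto
        ultimately have "segre_coord N l s' t' ?j1 = segre_coord N l s' t' ?j2"
          unfolding segre_coord_def by (intro arg_cong2[of _ _ _ _ "(*)"] prod.cong refl) auto
        then show "vanishes_at (\<lambda>p. p ?j1 - p ?j2) a"
          unfolding a vanishes_at_proj_point[OF form] by simp
      qed
      moreover have "segre_coord N l s t (j(N + 2 * r - 1 := a)) = t r a b" for a
        using segre_coord_pair[OF norm r, of "j(N + 2 * r - 1 := a)"] players
        by (simp add: j_def choice_profile_def)
      ultimately show ?thesis by simp
    qed
    have line: "segre_coord N l s t = line_coord N l (\<lambda>v. s v 1) (\<lambda>r. t r 2 1)"
    proof (rule segre_coord_cong)
      fix i a assume "i \<in> {1..N}"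
      then show "s i a = singleton_coords (\<lambda>v. s v 1) i a"
        using norm exhaust_2[of a] by (auto simp: normalized_def singleton_coords_def)
    next
      fix r a b assume r: "r \<in> {1..l}"
      then have "t r a b = t r 2 b" using rows[OF r, of b] exhaust_2[of a] by auto
      then show "t r a b = pair_coords (\<lambda>r. t r 2 1) r a b"
        using norm r exhaust_2[of b] by (auto simp: normalized_def pair_coords_def)
    qed
    show "x \<in> {proj_point ?J (line_coord N l y c) | y c. \<forall>i\<in>{1..N}. E i y = 0}"
      unfolding st line by (intro CollectI exI[of _ "\<lambda>v. s v 1"] exI[of _ "\<lambda>r. t r 2 1"] conjI refl solution)
  next
    fix x assume "x \<in> {proj_point ?J (line_coord N l y c) | y c. \<forall>i\<in>{1..N}. E i y = 0}"
    then obtain y c where x: "x = proj_point ?J (line_coord N l y c)" and y: "\<forall>i\<in>{1..N}. E i y = 0"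
      by blast
    have "line_coord N l y c (choice_profile ?n {}) = 1"
      using segre_coord_singletons[OF normalized_line, of "{}"] by simp
    then have "x \<in> proj_space ?J"
      unfolding x by (intro proj_point_in_proj_space[OF choice_profile_in_profiles[of ?n "{}"]]) simp
    moreover have "vanishes_at f x" if f: "form ?J d f" and fA: "\<forall>a\<in>A. vanishes_at f a" for d f
    proof -
      let ?\<gamma> = "\<lambda>\<epsilon>. line_coord N l y (\<lambda>r. c r + \<epsilon>)"
      let ?T = "(\<lambda>r. - c r) ` {1..l} \<union> (\<lambda>r. - 1 - c r) ` {1..l}"
      have "f (?\<gamma> 0) = 0"
      proof (rule form_vanishes_on_line[OF f, of ?T])
        show "finite ?T" by simp
        fix \<epsilon> :: real assume "\<epsilon> \<notin> ?T"
        have "c r + \<epsilon> \<noteq> 0 \<and> c r + \<epsilon> \<noteq> -1" if "r \<in> {1..l}" for r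
        proof -
          have "\<epsilon> \<noteq> - c r" "\<epsilon> \<noteq> - 1 - c r" using \<open>\<epsilon> \<notin> ?T\<close> that by blast+
          then show ?thesis by (intro conjI notI) linarith+
        qed
        then have "proj_point ?J (?\<gamma> \<epsilon>) \<in> A" by (intro mem[OF y])
        then show "f (?\<gamma> \<epsilon>) = 0" using fA vanishes_at_proj_point[OF f] by blast
      next
        fix j
        have "continuous_on UNIV (\<lambda>\<epsilon>. pair_coords (\<lambda>r. c r + \<epsilon>) r a b)" for r a b
          by (cases "b = 1") (auto simp: pair_coords_def intro!: continuous_intros)
        then show "continuous_on UNIV (\<lambda>\<epsilon>. ?\<gamma> \<epsilon> j)"
          unfolding segre_coord_def by (intro continuous_intros) auto
      qed
      then show ?thesis unfolding x vanishes_at_proj_point[OF f] by simp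
    qed
    ultimately have "x \<in> zariski_closure ?J A" unfolding zariski_closure_def by blast
    moreover have "x = segre ?n l (singleton_coords y) (pair_coords c)" by (simp add: x segre_eq)
    moreover have "\<forall>i\<in>{1..N}. singleton_coords y i 2 \<noteq> 0" "\<forall>r\<in>{1..l}. pair_coords c r 2 2 \<noteq> 0"
      by (simp_all add: singleton_coords_def pair_coords_def)
    ultimately show "x \<in> nash_ci_open ?n l X" unfolding open_eq by blast
  qed
  then show ?thesis by blast
qed

section \<open>Universality\<close>

theorem theorem32:
  fixes l m :: nat and S :: "(nat \<Rightarrow> real) set"
  assumes "affine_variety m S"
  shows "\<exists>n (X :: game). n \<ge> l \<and> n \<ge> 2 * l \<and>
    isomorphic_varieties (profiles n) (nash_ci_open n l X)
      {0..m + l} (affine_chart (m + l) ` times_affine_space m S l)"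
proof -
  obtain P where P: "finite P" "P \<subseteq> poly_fun {1..m}"
    and S: "S = {x \<in> {1..m} \<rightarrow>\<^sub>E UNIV. \<forall>h\<in>P. h x = 0}"
    using assms unfolding affine_variety_def by blast
  obtain N and E :: "nat \<Rightarrow> (nat \<Rightarrow> real) \<Rightarrow> real" and Q pos neg
    where system: "\<forall>i\<in>{1..N}. E i \<in> multiaffine ({1..N} - {i})"
      "\<forall>i\<in>{1..N}. form {0..m} 2 (Q i) \<and> (\<forall>w. w 0 \<noteq> 0 \<longrightarrow> Q i w > 0)"
      "\<forall>k\<in>{0..m}. pos k \<in> {1..N} \<and> neg k \<in> {1..N} \<and> (\<forall>w. Q (pos k) w - Q (neg k) w = w k * w 0)"
      "\<forall>y. (\<forall>i\<in>{1..N}. E i y = 0) \<longleftrightarrow>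
        (\<exists>w. w 0 = 1 \<and> (\<forall>h\<in>P. h w = 0) \<and> (\<forall>i\<in>{1..N}. y i = Q i w))"
    using positive_multiaffine_system[OF P] by (elim exE conjE) (rule that; assumption)
  have E: "E i \<in> multiaffine ({1..N} - {i})" and Q: "form {0..m} 2 (Q i)"
    and Q_pos: "w 0 \<noteq> 0 \<Longrightarrow> Q i w > 0" if "i \<in> {1..N}" for i w
    using system(1,2) that by blast+
  have posneg: "pos k \<in> {1..N} \<and> neg k \<in> {1..N}"
    and Q_diff: "Q (pos k) w - Q (neg k) w = w k * w 0" if "k \<in> {0..m}" for k w
    using system(3) that by blast+
  note sol = system(4)[rule_format]
  let ?n = "N + 2 * l" and ?K = "{0..m + l}" and ?T = "times_affine_space m S l"
  let ?J = "profiles ?n"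
  have "\<exists>X. nash_ci_open ?n l X =
      {proj_point ?J (line_coord N l y c) | y c. \<forall>i\<in>{1..N}. E i y = 0}"
  proof (rule nash_ci_open_realizing_game[OF E])
    fix y i assume "\<forall>i\<in>{1..N}. E i y = 0" "i \<in> {1..N}"
    then obtain w where "w 0 = 1" "y i = Q i w" using sol[of y] by auto
    then show "y i > 0" using Q_pos[of i w] \<open>i \<in> {1..N}\<close> by simp
  qed
  then obtain X where X: "nash_ci_open ?n l X =
      {proj_point ?J (line_coord N l y c) | y c. \<forall>i\<in>{1..N}. E i y = 0}" ..
  \<comment> \<open>\<open>w z\<close> are the homogeneous coordinates of the affine point \<open>z\<close>, and \<open>f z\<close> those of the
    corresponding point of the Nash conditional independence variety.\<close>
  define w where "w z k = (if k = 0 then 1 else z k)" for z :: "nat \<Rightarrow> real" and k :: nat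
  define f where "f z = line_coord N l (\<lambda>i. Q i (w z)) (\<lambda>r. z (m + r))" for z
  have T: "z \<in> ?T \<longleftrightarrow> z \<in> {1..m + l} \<rightarrow>\<^sub>E UNIV \<and> (\<forall>h\<in>P. h (w z) = 0)" for z
  proof -
    have "h (restrict z {1..m}) = h (w z)" if "h \<in> P" for h
      by (rule poly_fun_cong[of h "{1..m}"]) (use P that in \<open>auto simp: w_def\<close>)
    then have "(\<forall>h\<in>P. h (restrict z {1..m}) = 0) \<longleftrightarrow> (\<forall>h\<in>P. h (w z) = 0)" by metis
    then show ?thesis by (simp add: times_affine_space_def S)
  qed
  have U: "nash_ci_open ?n l X = (\<lambda>z. proj_point ?J (f z)) ` ?T"
  proof (intro equalityI subsetI)
    fix x assume "x \<in> nash_ci_open ?n l X"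
    then obtain y c where x: "x = proj_point ?J (line_coord N l y c)" and "\<forall>i\<in>{1..N}. E i y = 0"
      unfolding X by blast
    then obtain v where v: "v 0 = 1" "\<forall>h\<in>P. h v = 0" "\<forall>i\<in>{1..N}. y i = Q i v" using sol by auto
    define z where "z = (\<lambda>k\<in>{1..m + l}. if k \<le> m then v k else c (k - m))"
    have wz: "w z k = v k" if "k \<in> {0..m}" for k using that v(1) by (auto simp: w_def z_def)
    have "h (w z) = h v" if "h \<in> P" for h
      by (rule poly_fun_cong[of h "{1..m}"]) (use P that wz in auto)
    then have "\<forall>h\<in>P. h (w z) = 0" using v(2) by metis
    then have "z \<in> ?T" unfolding T by (simp add: z_def)
    moreover have "line_coord N l y c = f z"
      unfolding f_def
    proof (rule segre_coord_cong)
      fix i a assume i: "i \<in> {1..N}"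
      have "Q i (w z) = Q i v" by (rule form_cong[OF Q[OF i] wz])
      then show "singleton_coords y i a = singleton_coords (\<lambda>i. Q i (w z)) i a"
        using v(3) i by (simp add: singleton_coords_def)
    next
      fix r a b assume "r \<in> {1..l}"
      then show "pair_coords c r a b = pair_coords (\<lambda>r. z (m + r)) r a b"
        by (auto simp: pair_coords_def z_def)
    qed
    ultimately show "x \<in> (\<lambda>z. proj_point ?J (f z)) ` ?T" unfolding x by auto
  next
    fix x assume "x \<in> (\<lambda>z. proj_point ?J (f z)) ` ?T"
    then obtain z where z: "z \<in> ?T" "x = proj_point ?J (f z)" by blast
    have "\<forall>i\<in>{1..N}. E i (\<lambda>i. Q i (w z)) = 0"
      unfolding sol using z(1) by (intro exI[of _ "w z"]) (auto simp: T w_def)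
    then show "x \<in> nash_ci_open ?n l X" unfolding X z(2) f_def by blast
  qed
  have chart: "affine_chart (m + l) ` ?T = (\<lambda>z. proj_point ?K (w z)) ` ?T"
    by (simp add: affine_chart_def w_def[abs_def])
  \<comment> \<open>The differences evaluate to \<open>w k * w 0\<close>, which is \<open>w k\<close> since \<open>w 0 = 1\<close>. The last profile is
    chosen because its coordinate is the entry \<open>c r\<close> in the second row of pair \<open>r\<close>.\<close>
  define F where "F k p = (if k \<le> m
      then p (choice_profile ?n {pos k}) - p (choice_profile ?n {neg k})
      else p (choice_profile ?n {N + 2 * (k - m)}))" for k and p :: "(nat \<Rightarrow> 2) \<Rightarrow> real"
  \<comment> \<open>These are the coordinates of \<open>f z\<close>, where each factor is homogenized by powers of \<open>v 0\<close> to have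
    the same degree for both choices.\<close>
  define G where "G j v = (\<Prod>i\<in>{1..N}. if j i = 1 then Q i v else v 0 ^ 2) *
      (\<Prod>r\<in>{1..l}. v (if j (N + 2 * r) = 1 then m + r else 0))" for j :: "nat \<Rightarrow> 2" and v
  have "isomorphic_varieties ?J ((\<lambda>z. proj_point ?J (f z)) ` ?T) ?K ((\<lambda>z. proj_point ?K (w z)) ` ?T)"
  proof (rule isomorphic_varieties_by_forms[where F = F and G = G])
    fix k
    show "form ?J 1 (F k)"
      by (cases "k \<le> m") (simp_all add: F_def[abs_def] form_diff form_coord[unfolded One_nat_def] choice_profile_in_profiles)
  next
    fix j :: "nat \<Rightarrow> 2"
    have sq: "form ?K 2 (\<lambda>v. v 0 ^ 2)" using form_power[OF form_coord, of 0 ?K 2] by simp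
    have "form ?K 2 (Q i)" if "i \<in> {1..N}" for i using form_mono[OF Q[OF that]] by simp
    with sq have "form ?K 2 (\<lambda>v. if j i = 1 then Q i v else v 0 ^ 2)" if "i \<in> {1..N}" for i
      using that by (cases "j i = 1") simp_all
    then have "form ?K (card {1..N} * 2) (\<lambda>v. \<Prod>i\<in>{1..N}. if j i = 1 then Q i v else v 0 ^ 2)"
      by (rule form_prod[OF finite_atLeastAtMost])
    moreover have "form ?K (card {1..l} * 1) (\<lambda>v. \<Prod>r\<in>{1..l}. v (if j (N + 2 * r) = 1 then m + r else 0))"
      by (intro form_prod form_coord) auto
    ultimately show "form ?K (card {1..N} * 2 + card {1..l} * 1) (G j)"
      unfolding G_def[abs_def] by (rule form_mult)
  next
    fix z :: "nat \<Rightarrow> real"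
    have "f z (choice_profile ?n {}) = 1"
      using segre_coord_singletons[OF normalized_line, of "{}"] by (simp add: f_def)
    then show "\<exists>j\<in>?J. f z j \<noteq> 0" using choice_profile_in_profiles by (metis zero_neq_one)
    show "\<exists>k\<in>?K. w z k \<noteq> 0" by (intro bexI[of _ 0]) (auto simp: w_def)
  next
    fix z :: "nat \<Rightarrow> real" and k assume k: "k \<in> ?K"
    show "F k (f z) = w z k"
    proof (cases "k \<le> m")
      case True
      then have "f z (choice_profile ?n {pos k}) = Q (pos k) (w z)" "f z (choice_profile ?n {neg k}) = Q (neg k) (w z)"
        using segre_coord_singletons[OF normalized_line, of "{pos k}"] posneg[of k]
          segre_coord_singletons[OF normalized_line, of "{neg k}"]
        by (simp_all add: f_def singleton_coords_def)
      then show ?thesis using True Q_diff[of k "w z"] by (simp add: F_def) (simp add: w_def)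
    next
      case False
      then have r: "k - m \<in> {1..l}" using k by auto
      let ?e = "choice_profile ?n {N + 2 * (k - m)}"
      have "f z ?e = pair_coords (\<lambda>r. z (m + r)) (k - m) (?e (N + 2 * (k - m) - 1)) (?e (N + 2 * (k - m)))"
        unfolding f_def by (rule segre_coord_pair[OF normalized_line r]) (auto simp: choice_profile_def)
      moreover have "?e (N + 2 * (k - m)) = 1" using r by (simp add: choice_profile_def)
      ultimately show ?thesis using False by (simp add: F_def pair_coords_def w_def)
    qed
  next
    fix z :: "nat \<Rightarrow> real" and j :: "nat \<Rightarrow> 2"
    show "G j (w z) = f z j"
      unfolding G_def f_def segre_coord_def
      by (intro arg_cong2[of _ _ _ _ "(*)"] prod.cong refl)
        (auto simp: singleton_coords_def pair_coords_def w_def)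
  qed
  then have "isomorphic_varieties ?J (nash_ci_open ?n l X) ?K (affine_chart (m + l) ` ?T)"
    unfolding U chart .
  then show ?thesis by (intro exI[of _ ?n] exI[of _ X]) simp
qed

end
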